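(* Let $\mathcal{L}:\sum_{i\in[k]}c_ix_i=0$ with $k\ge3$ and $c_1,\dots,c_k\in\mathbb{Z}\setminus\{0\}$ be degenerate, i.e. there exists a non-empty $S\subseteq[k]$ with $\sum_{s\in S}c_s=0$. Then for every $\varepsilon>0$, $$d(\mathcal{L},\varepsilon)\le 100^{k+1}k^3\varepsilon.$$
   Context: For a prime $p$, a set $A\subseteq\mathbb{F}_p$ is solution-free for $\mathcal{L}$ if there is no $k$-tuple of pairwise distinct elements $a_1,\dots,a_k\in A$ with $\sum_i c_ia_i=0$ in $\mathbb{F}_p$. The Cayley graph $\mathrm{Cay}_{\mathbb{F}_p}(A)$ is the digraph on $\mathbb{F}_p$ with an arc $\vec{uv}$ iff $v-u\in A$; $\alpha$ of a digraph is the independence number of its underlying undirected graph. $D(\mathcal{L},\varepsilon,p)$ is the maximum size of a solution-free set $A$ of $\mathcal{L}$ in $\mathbb{F}_p$ with $\alpha(\mathrm{Cay}_{\mathbb{F}_p}(A))\le\varepsilon p$, and $d(\mathcal{L},\varepsilon):=\limsup_{p\to\infty,\ p\text{ prime}} D(\mathcal{L},\varepsilon,p)/p$. *)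

theory Defs
  imports
    "HOL-Analysis.Analysis"
    "HOL-Number_Theory.Cong"
    "Graph_Theory.Digraph_Component"
begin

text \<open>
  An equation \<open>c\<^sub>1 x\<^sub>1 + \<dots> + c\<^sub>k x\<^sub>k = 0\<close> is given by its length \<open>k\<close> and a coefficient function
  \<open>c\<close>, of which only the values on \<open>{1..k}\<close> matter. Elements of the field of \<open>p\<close> elements are
  represented by their least nonnegative residues.
\<close>

definition degenerate :: "nat \<Rightarrow> (nat \<Rightarrow> int) \<Rightarrow> bool" where
  "degenerate k c \<longleftrightarrow> (\<exists>S. S \<subseteq> {1..k} \<and> S \<noteq> {} \<and> (\<Sum>s\<in>S. c s) = 0)"

definition Fp :: "nat \<Rightarrow> int set" where
  "Fp p = {0..<int p}"

definition solution_free :: "nat \<Rightarrow> (nat \<Rightarrow> int) \<Rightarrow> nat \<Rightarrow> int set \<Rightarrow> bool" where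
  "solution_free k c p A \<longleftrightarrow>
     \<not> (\<exists>a :: nat \<Rightarrow> int. (\<forall>i\<in>{1..k}. a i \<in> A) \<and> inj_on a {1..k} \<and>
          [(\<Sum>i\<in>{1..k}. c i * a i) = 0] (mod int p))"

definition cayley_digraph :: "nat \<Rightarrow> int set \<Rightarrow> int pair_pre_digraph" where
  "cayley_digraph p A =
     \<lparr> pverts = Fp p, parcs = {(u, v). u \<in> Fp p \<and> v \<in> Fp p \<and> (v - u) mod int p \<in> A} \<rparr>"

text \<open>
  The underlying undirected graph is taken to be simple: the loops that the Cayley digraph has
  when \<open>0 \<in> A\<close> do not affect independence, hence the condition \<open>u \<noteq> v\<close>.
\<close>

definition independent_set :: "('a, 'b) pre_digraph \<Rightarrow> 'a set \<Rightarrow> bool" where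
  "independent_set G I \<longleftrightarrow>
     I \<subseteq> verts G \<and> (\<forall>u\<in>I. \<forall>v\<in>I. u \<noteq> v \<longrightarrow> (u, v) \<notin> parcs (mk_symmetric G))"

definition independence_number :: "('a, 'b) pre_digraph \<Rightarrow> nat" where
  "independence_number G = Max (card ` {I. independent_set G I})"

text \<open>
  The set below is finite, so the supremum is a maximum whenever some set \<open>A\<close> qualifies;
  if none does (possible for \<open>\<epsilon> < 1\<close>), the value is \<open>0\<close>, the supremum of the empty set
  of natural numbers.
\<close>

definition D_max :: "nat \<Rightarrow> (nat \<Rightarrow> int) \<Rightarrow> real \<Rightarrow> nat \<Rightarrow> nat" where
  "D_max k c \<epsilon> p =
     Sup (card ` {A. A \<subseteq> Fp p \<and> solution_free k c p A \<and>
       real (independence_number (with_proj (cayley_digraph p A))) \<le> \<epsilon> * real p})"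

definition d_limsup :: "nat \<Rightarrow> (nat \<Rightarrow> int) \<Rightarrow> real \<Rightarrow> ereal" where
  "d_limsup k c \<epsilon> =
     Limsup (inf sequentially (principal {p. prime p}))
       (\<lambda>p. ereal (real (D_max k c \<epsilon> p) / real p))"

end

theory Submission
  imports Defs
begin

text \<open>
  Let \<open>S\<close> be a set of indices with zero coefficient sum, \<open>T\<close> its complement and \<open>i \<in> S\<close>. If \<open>T\<close> is
  empty, the bound is Roth's theorem for a translation-invariant equation. Otherwise Roth's theorem
  shows that for all but \<open>\<epsilon> p\<close> elements \<open>z'\<close> of a solution-free set \<open>A\<close> one can write
  \<open>- c\<^sub>i z' = (\<Sum>s \<in> S - {i}. c\<^sub>s y\<^sub>s)\<close> with distinct \<open>y\<^sub>s\<close> in \<open>A\<close> avoiding any prescribed \<open>k\<close> elements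
  other than \<open>z'\<close>. It then suffices to find distinct \<open>x\<^sub>t\<close> in \<open>A\<close> such that
  \<open>c\<^sub>i z' = c\<^sub>i z + (\<Sum>t \<in> T. c\<^sub>t x\<^sub>t)\<close> with \<open>z\<close> in \<open>A\<close>: a walk from \<open>c\<^sub>i z\<close> to \<open>c\<^sub>i z'\<close> whose steps are
  taken in the Cayley graphs of the dilates \<open>c\<^sub>t A\<close>, all of which have independence number at most
  \<open>\<epsilon> p\<close>. Such a walk is extended step by step; as each step has to avoid only boundedly many labels,
  it fails on a set of at most \<open>(4k + 3) \<epsilon> p\<close> points.
\<close>

subsection \<open>Sparse digraphs\<close>

text \<open>Greedy choice: double counting the arcs inside \<open>V\<close> yields a vertex of
  in-degree at most \<open>K\<close>. It is kept, and it is deleted together with its in- and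
  out-neighbours, at most \<open>2 * K + 1\<close> points, before continuing.\<close>

lemma sparse_digraph_independent_set:
  fixes F :: "'a \<Rightarrow> 'a set"
  assumes "finite V" and "\<And>v. v \<in> V \<Longrightarrow> finite (F v) \<and> card (F v) \<le> K"
  shows "\<exists>U\<subseteq>V. card V \<le> (2 * K + 1) * card U \<and> (\<forall>u\<in>U. \<forall>v\<in>U. u \<noteq> v \<longrightarrow> v \<notin> F u)"
  using assms
proof (induction "card V" arbitrary: V rule: less_induct)
  case less
  show ?case
  proof (cases "V = {}")
    case True
    then show ?thesis by auto
  next
    case False
    define indeg where "indeg v = {u \<in> V. v \<in> F u}" for v
    have fin: "finite (indeg v)" for v
      unfolding indeg_def using less.prems(1) by simp
    have "\<exists>v\<in>V. card (indeg v) \<le> K"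
    proof (rule ccontr)
      assume "\<not> ?thesis"
      then have "(K + 1) * card V \<le> (\<Sum>v\<in>V. card (indeg v))"
        using sum_mono[of V "\<lambda>_. K + 1" "\<lambda>v. card (indeg v)"] by (simp add: mult.commute not_le Suc_le_eq)
      also have "\<dots> = (\<Sum>v\<in>V. \<Sum>u\<in>V. if v \<in> F u then 1 else 0)"
        unfolding indeg_def using less.prems(1) by (simp add: sum.If_cases Int_def)
      also have "\<dots> = (\<Sum>u\<in>V. \<Sum>v\<in>V. if v \<in> F u then 1 else 0)"
        by (rule sum.swap)
      also have "\<dots> = (\<Sum>u\<in>V. card (V \<inter> F u))"
        using less.prems(1) by (simp add: sum.If_cases Int_def)
      also have "\<dots> \<le> (\<Sum>u\<in>V. K)"
        by (rule sum_mono) (use less.prems(2) in \<open>meson card_mono inf_le2 order_trans\<close>)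
      finally show False
        using less.prems(1) False by (simp add: mult.commute card_eq_0_iff)
    qed
    then obtain v where v: "v \<in> V" "card (indeg v) \<le> K" by blast
    define R where "R = insert v (F v \<union> indeg v)"
    have finR: "finite R" unfolding R_def using fin less.prems(2)[OF v(1)] by simp
    have "card R \<le> Suc (card (F v \<union> indeg v))"
      unfolding R_def by (rule card_insert_le_m1) auto
    also have "card (F v \<union> indeg v) \<le> K + K"
      using card_Un_le[of "F v" "indeg v"] less.prems(2)[OF v(1)] v(2) by linarith
    finally have cR: "card R \<le> 2 * K + 1" by simp
    have "card (V - R) < card V"
      using v(1) less.prems(1) by (intro psubset_card_mono) (auto simp: R_def)
    from less.hyps[OF this] less.prems obtain U where
      U: "U \<subseteq> V - R" "card (V - R) \<le> (2 * K + 1) * card U" "\<forall>u\<in>U. \<forall>v\<in>U. u \<noteq> v \<longrightarrow> v \<notin> F u"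
      by (metis Diff_iff finite_Diff)
    have vU: "v \<notin> U" using U(1) R_def by auto
    have finU: "finite U" using U(1) less.prems(1) by (meson finite_Diff finite_subset)
    have "card V \<le> card (V - R) + card R"
      by (metis add_le_cancel_left card_Un_le card_mono diff_card_le_card_Diff finR le_diff_conv)
    also have "\<dots> \<le> (2 * K + 1) * card (insert v U)"
      using U(2) cR vU finU by simp
    finally have "card V \<le> (2 * K + 1) * card (insert v U)" .
    moreover have "\<forall>u\<in>insert v U. \<forall>w\<in>insert v U. u \<noteq> w \<longrightarrow> w \<notin> F u"
      using U(1,3) by (auto simp: R_def indeg_def)
    ultimately show ?thesis
      using U(1) v(1) by (intro exI[of _ "insert v U"]) auto
  qed
qed

subsection \<open>Roth's theorem for weighted means\<close>

definition weighted_mean_free :: "int \<Rightarrow> int \<Rightarrow> int set \<Rightarrow> bool" where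
  "weighted_mean_free a b B \<longleftrightarrow>
     (\<forall>x\<in>B. \<forall>y\<in>B. \<forall>z\<in>B. a * x + b * y = (a + b) * z \<longrightarrow> x = y)"

section \<open>Affine invariance and counting along progressions\<close>

lemma weighted_mean_free_affine:
  assumes "weighted_mean_free a b B" "D \<noteq> 0" "\<And>j. j \<in> C \<Longrightarrow> s + j * D \<in> B"
  shows "weighted_mean_free a b C"
  unfolding weighted_mean_free_def
proof (intro ballI impI)
  fix x y z assume *: "x \<in> C" "y \<in> C" "z \<in> C" "a * x + b * y = (a + b) * z"
  have "a * (s + x * D) + b * (s + y * D) = (a + b) * s + (a * x + b * y) * D"
    by (simp add: algebra_simps)
  also have "\<dots> = (a + b) * (s + z * D)" by (simp add: * algebra_simps)
  finally have "s + x * D = s + y * D"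
    using assms(1,3) * unfolding weighted_mean_free_def by blast
  then show "x = y" using assms(2) by simp
qed

text \<open>The \<open>y\<close> with \<open>y - D \<notin> M\<close> start the maximal progressions
  of difference \<open>D\<close> in \<open>M\<close>. Each is cut into blocks of length
  \<open>L\<close>, where affine invariance gives density at most \<open>e\<close>, and at most one
  shorter remainder, counted trivially.\<close>

lemma card_Int_le_starts:
  fixes B M :: "int set"
  assumes L: "L \<ge> 1" "\<And>C. C \<subseteq> {0..<int L} \<Longrightarrow> weighted_mean_free a b C \<Longrightarrow> real (card C) \<le> e * real L"
    and "e \<ge> 0" "D \<ge> 1" "weighted_mean_free a b B" "finite M"
  shows "real (card (B \<inter> M)) \<le> e * real (card M) + real L * real (card {y \<in> M. y - D \<notin> M})"
  using \<open>finite M\<close>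
proof (induction "card M" arbitrary: M rule: less_induct)
  case less
  show ?case
  proof (cases "M = {}")
    case True
    then show ?thesis by simp
  next
    case False
    define y where "y = Min M"
    have yM: "y \<in> M" and ymin: "\<And>z. z \<in> M \<Longrightarrow> y \<le> z"
      unfolding y_def using less.prems False by auto
    \<comment> \<open>Length of the run of difference \<open>D\<close> from the minimum, truncated
      at \<open>L\<close>.\<close>
    define n where "n = (LEAST n. n = L \<or> y + int n * D \<notin> M)"
    have n: "n = L \<or> y + int n * D \<notin> M"
      unfolding n_def by (rule LeastI[of _ L]) simp
    have nL: "n \<le> L" unfolding n_def by (rule Least_le) simp
    have inM: "y + int j * D \<in> M" if "j < n" for j
      using not_less_Least[OF that[unfolded n_def]] by blast
    have n0: "n > 0" using n L(1) yM by (cases n) auto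
    define R where "R = (\<lambda>j. y + int j * D) ` {..<n}"
    have inj: "inj_on (\<lambda>j. y + int j * D) X" for X :: "nat set"
      using \<open>D \<ge> 1\<close> by (auto simp: inj_on_def)
    have cR: "card R = n" unfolding R_def by (simp add: card_image[OF inj])
    have RM: "R \<subseteq> M" and finR: "finite R" unfolding R_def using inM by auto
    have yR: "y \<in> R" unfolding R_def using n0 by force
    define st where "st X = {y \<in> X. y - D \<notin> X}" for X
    have fst: "finite (st M)" unfolding st_def using less.prems by simp
    have yst: "y \<in> st M" unfolding st_def using yM ymin[of "y - D"] \<open>D \<ge> 1\<close> by auto
    have cM: "card (M - R) = card M - n"
      using card_Diff_subset[OF finR RM] cR by simp
    have nM: "n \<le> card M" using card_mono[OF less.prems RM] cR by simp
    have IH: "real (card (B \<inter> (M - R))) \<le> e * real (card (M - R)) + real L * real (card (st (M - R)))"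
      unfolding st_def by (rule less.hyps) (use cM nM n0 less.prems in auto)
    have split: "card (B \<inter> M) = card (B \<inter> (M - R)) + card (B \<inter> R)"
      by (subst card_Un_disjoint[symmetric])
         (use less.prems finR RM in \<open>auto intro!: arg_cong[where f = card]\<close>)
    \<comment> \<open>Deleting the run removes the start \<open>y\<close> and can create only one
      new start, its continuation. So a full block costs no start, and a shorter run, whose
      continuation is outside \<open>M\<close>, saves one, which pays for its at most
      \<open>L\<close> points.\<close>
    have st_sub: "st (M - R) \<subseteq> insert (y + int n * D) (st M - {y})"
    proof
      fix z assume z: "z \<in> st (M - R)"
      show "z \<in> insert (y + int n * D) (st M - {y})"
      proof (cases "z - D \<in> M")
        case True
        with z have "z - D \<in> R" "z \<notin> R" unfolding st_def by auto
        then obtain j where j: "j < n" "z - D = y + int j * D" unfolding R_def by auto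
        then have z': "z = y + int (Suc j) * D" by (simp add: algebra_simps)
        with \<open>z \<notin> R\<close> have "\<not> Suc j < n" unfolding R_def by blast
        with j(1) have "Suc j = n" by simp
        with z' show ?thesis by simp
      next
        case False
        with z yR show ?thesis unfolding st_def by auto
      qed
    qed
    show ?thesis
    proof (cases "n = L")
      case True
      define C where "C = int ` {j. j < L \<and> y + int j * D \<in> B}"
      have "card (B \<inter> R) = card ((\<lambda>j. y + int j * D) ` {j. j < L \<and> y + int j * D \<in> B})"
        unfolding R_def True by (intro arg_cong[where f = card]) auto
      also have "\<dots> = card C"
        unfolding C_def by (simp add: card_image[OF inj] card_image)
      finally have "card (B \<inter> R) = card C" .
      moreover have "weighted_mean_free a b C"
        by (rule weighted_mean_free_affine[OF assms(5), of D _ y]) (use \<open>D \<ge> 1\<close> in \<open>auto simp: C_def\<close>)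
      moreover have "C \<subseteq> {0..<int L}" unfolding C_def by auto
      ultimately have BR: "real (card (B \<inter> R)) \<le> e * real n" using L(2) True by simp
      have "card (st (M - R)) \<le> card (insert (y + int n * D) (st M - {y}))"
        by (rule card_mono[OF _ st_sub]) (use fst in simp)
      also have "\<dots> \<le> Suc (card (st M - {y}))" by (rule card_insert_le_m1) auto
      also have "\<dots> = card (st M)" using fst yst by (metis card_Suc_Diff1)
      finally have "real L * real (card (st (M - R))) \<le> real L * real (card (st M))"
        by (simp add: mult_left_mono)
      moreover have "e * real (card (M - R)) + e * real n = e * real (card M)"
        using cM nM by (simp add: of_nat_diff algebra_simps)
      ultimately show ?thesis using IH BR split unfolding st_def by simp
    next
      case False
      with n have "y + int n * D \<notin> M" by simp
      then have "st (M - R) \<subseteq> st M - {y}" using st_sub unfolding st_def by auto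
      then have "card (st (M - R)) \<le> card (st M - {y})" using fst by (simp add: card_mono)
      then have "card (st (M - R)) + 1 \<le> card (st M)" using fst yst by (metis Suc_eq_plus1 Suc_le_mono card_Suc_Diff1)
      then have "real L * (real (card (st (M - R))) + 1) \<le> real L * real (card (st M))"
        by (intro mult_left_mono) auto
      moreover have "card (B \<inter> R) \<le> L"
        using card_mono[OF finR, of "B \<inter> R"] cR nL by simp
      moreover have "e * real (card (M - R)) \<le> e * real (card M)"
        using cM \<open>e \<ge> 0\<close> by (intro mult_left_mono) auto
      ultimately show ?thesis using IH split unfolding st_def by (simp add: algebra_simps)
    qed
  qed
qed

section \<open>Popular differences and Hilbert cubes\<close>

lemma card_Union_translates:
  fixes B :: "int set"
  assumes "finite B" and "\<And>d. 1 \<le> d \<Longrightarrow> d < int n \<Longrightarrow> real (card {x \<in> B. x + d \<in> B}) \<le> m" and "m \<ge> 0"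
  shows "real n * real (card B) \<le> real (card (\<Union>j<n. (+) (int j) ` B)) + real n * real n * m"
  using assms(2)
proof (induction n)
  case 0
  then show ?case by simp
next
  case (Suc n)
  define U where "U = (\<Union>j<n. (+) (int j) ` B)"
  define V where "V = (+) (int n) ` B"
  have fin: "finite U" "finite V" unfolding U_def V_def using assms(1) by auto
  have "card V = card B" unfolding V_def by (simp add: card_image)
  \<comment> \<open>The new translate meets the \<open>j\<close>-th earlier one in a copy of
    \<open>{x \<in> B. x + (n - j) \<in> B}\<close>, so only differences below the number of
    translates occur.\<close>
  have "card (U \<inter> V) \<le> (\<Sum>j<n. card ((+) (int j) ` B \<inter> V))"
  proof -
    have "U \<inter> V = (\<Union>j<n. (+) (int j) ` B \<inter> V)" unfolding U_def by auto
    then show ?thesis using card_UN_le[of "{..<n}" "\<lambda>j. (+) (int j) ` B \<inter> V"] by simp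
  qed
  then have "real (card (U \<inter> V)) \<le> (\<Sum>j<n. real (card ((+) (int j) ` B \<inter> V)))"
    by (metis of_nat_le_iff of_nat_sum)
  also have "\<dots> \<le> (\<Sum>j<n. m)"
  proof (rule sum_mono)
    fix j assume "j \<in> {..<n}"
    then have j: "j < n" by simp
    have "(+) (int j) ` B \<inter> V = (+) (int n) ` {x \<in> B. x + (int n - int j) \<in> B}"
    proof (intro equalityI subsetI)
      fix x assume "x \<in> (+) (int j) ` B \<inter> V"
      then obtain u v where uv: "u \<in> B" "v \<in> B" "x = int j + u" "x = int n + v" unfolding V_def by auto
      then have "v + (int n - int j) = u" by simp
      with uv show "x \<in> (+) (int n) ` {x \<in> B. x + (int n - int j) \<in> B}" by auto
    next
      fix x assume "x \<in> (+) (int n) ` {x \<in> B. x + (int n - int j) \<in> B}"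
      then obtain v where v: "v \<in> B" "v + (int n - int j) \<in> B" "x = int n + v" by auto
      then have "x = int j + (v + (int n - int j))" by simp
      with v show "x \<in> (+) (int j) ` B \<inter> V" unfolding V_def by blast
    qed
    then have "card ((+) (int j) ` B \<inter> V) = card {x \<in> B. x + (int n - int j) \<in> B}"
      by (simp add: card_image)
    then show "real (card ((+) (int j) ` B \<inter> V)) \<le> m" using Suc.prems[of "int n - int j"] j by simp
  qed
  finally have UV: "real (card (U \<inter> V)) \<le> real n * m" by simp
  have "card U + card V = card (U \<union> V) + card (U \<inter> V)" by (rule card_Un_Int[OF fin])
  moreover have "(\<Union>j<Suc n. (+) (int j) ` B) = U \<union> V" unfolding U_def V_def by (auto simp: lessThan_Suc)
  moreover have "real n * real (card B) \<le> real (card U) + real n * real n * m"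
    unfolding U_def by (rule Suc.IH) (use Suc.prems in auto)
  moreover have "real n * real n * m + real n * m \<le> real (Suc n) * real (Suc n) * m"
    using \<open>m \<ge> 0\<close> by (simp add: algebra_simps)
  ultimately show ?case using UV \<open>card V = card B\<close> by (simp add: algebra_simps)
qed

text \<open>Pigeonhole: \<open>n\<close> translates of \<open>B\<close> have total size at least
  \<open>3 * N\<close> but lie in an interval of length at most \<open>2 * N\<close>, so two of them
  overlap substantially.\<close>

lemma popular_small_difference:
  fixes \<eta> :: real
  assumes "\<eta> > 0"
  shows "\<exists>(t::nat) \<eta>' N0. \<eta>' > 0 \<and> (\<forall>N\<ge>N0. \<forall>B. B \<subseteq> {0..<int N} \<longrightarrow> \<eta> * real N \<le> real (card B) \<longrightarrow>
           (\<exists>d. 1 \<le> d \<and> d \<le> int t \<and> \<eta>' * real N \<le> real (card {x \<in> B. x + d \<in> B})))"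
proof -
  obtain n :: nat where n: "real n \<ge> 3 / \<eta>" using real_arch_simple by blast
  then have n3: "real n * \<eta> \<ge> 3" using assms by (simp add: field_simps)
  then have n0: "n > 0" by (cases n) auto
  \<comment> \<open>With this value the overlaps account for at most \<open>N / 2\<close>, and
    \<open>3 * N \<le> 2 * N + N / 2\<close> is absurd.\<close>
  define \<eta>' where "\<eta>' = 1 / (2 * real n * real n)"
  show ?thesis
  proof (intro exI[of _ n] exI[of _ \<eta>'] conjI allI impI)
    show "\<eta>' > 0" using n0 by (simp add: \<eta>'_def)
    fix N :: nat and B :: "int set" assume N: "N \<ge> n" and B: "B \<subseteq> {0..<int N}" and c: "\<eta> * real N \<le> real (card B)"
    show "\<exists>d. 1 \<le> d \<and> d \<le> int n \<and> \<eta>' * real N \<le> real (card {x \<in> B. x + d \<in> B})"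
    proof (rule ccontr)
      assume neg: "\<not> ?thesis"
      have finB: "finite B" using B by (rule finite_subset) simp
      have "real n * real (card B) \<le> real (card (\<Union>j<n. (+) (int j) ` B)) + real n * real n * (\<eta>' * real N)"
      proof (rule card_Union_translates[OF finB])
        fix d :: int assume d: "1 \<le> d" "d < int n"
        have "\<not> \<eta>' * real N \<le> real (card {x \<in> B. x + d \<in> B})"
          using neg d by simp
        then show "real (card {x \<in> B. x + d \<in> B}) \<le> \<eta>' * real N" by linarith
      qed (simp add: \<eta>'_def)
      also have "real n * real n * (\<eta>' * real N) = real N / 2"
        using n0 by (simp add: \<eta>'_def)
      also have "card (\<Union>j<n. (+) (int j) ` B) \<le> card {0..<int (N + n)}"
      proof (rule card_mono)
        show "(\<Union>j<n. (+) (int j) ` B) \<subseteq> {0..<int (N + n)}"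
        proof (intro UN_least subsetI)
          fix j x assume "j \<in> {..<n}" "x \<in> (+) (int j) ` B"
          then obtain y where "y \<in> B" "x = int j + y" "j < n" by auto
          then show "x \<in> {0..<int (N + n)}" using subsetD[OF B, of y] by simp
        qed
      qed simp
      also have "card {0..<int (N + n)} \<le> 2 * N" using N by simp
      finally have "real n * real (card B) \<le> 2 * real N + real N / 2" by simp
      moreover have "3 * real N \<le> (real n * \<eta>) * real N" using n3 by (intro mult_right_mono) auto
      moreover have "(real n * \<eta>) * real N \<le> real n * real (card B)"
        using c by (simp add: mult.assoc mult_left_mono)
      ultimately have "real N \<le> 0" by simp
      with N n0 show False by simp
    qed
  qed
qed

text \<open>The sums of \<open>m\<close> with subfamilies of \<open>D 0\<close>, ...,
  \<open>D (i - 1)\<close>. The recursion exposes the shift by \<open>D i\<close> on which the chain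
  argument rests.\<close>

fun hilbert_cube :: "int \<Rightarrow> (nat \<Rightarrow> int) \<Rightarrow> nat \<Rightarrow> int set" where
  "hilbert_cube m D 0 = {m}"
| "hilbert_cube m D (Suc i) = hilbert_cube m D i \<union> (\<lambda>x. x + D i) ` hilbert_cube m D i"

lemma hilbert_cube_cong: "(\<And>j. j < i \<Longrightarrow> D j = D' j) \<Longrightarrow> hilbert_cube m D i = hilbert_cube m D' i"
  by (induction i) auto

lemma hilbert_cube_base: "m \<in> hilbert_cube m D i"
  by (induction i) auto

lemma hilbert_cube_mono: "i \<le> j \<Longrightarrow> hilbert_cube m D i \<subseteq> hilbert_cube m D j"
  by (induction j) (auto simp: le_Suc_eq)

lemma finite_hilbert_cube: "finite (hilbert_cube m D i)"
  by (induction i) auto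

lemma card_hilbert_cube: "card (hilbert_cube m D i) \<le> 2 ^ i"
proof (induction i)
  case (Suc i)
  have "card (hilbert_cube m D (Suc i)) \<le> card (hilbert_cube m D i) + card ((\<lambda>x. x + D i) ` hilbert_cube m D i)"
    by (simp add: card_Un_le)
  also have "\<dots> \<le> 2 ^ Suc i"
    using Suc card_image_le[OF finite_hilbert_cube, of "\<lambda>x. x + D i" m D i] by simp
  finally show ?case .
qed simp

text \<open>A popular difference \<open>d\<close> leaves the dense set
  \<open>{x \<in> B. x + d \<in> B}\<close>, and a \<open>k\<close>-dimensional cube in it extends
  within \<open>B\<close> by the step \<open>d\<close>. The density drops in each round, so
  \<open>\<eta>\<close> is generalised; the bound on the steps stays free of
  \<open>N\<close>.\<close>

lemma dense_contains_hilbert_cube: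
  fixes \<eta> :: real
  assumes "\<eta> > 0"
  shows "\<exists>(W::nat) N0. \<forall>N\<ge>N0. \<forall>B. B \<subseteq> {0..<int N} \<longrightarrow> \<eta> * real N \<le> real (card B) \<longrightarrow>
           (\<exists>m D. (\<forall>i<k. 1 \<le> D i \<and> D i \<le> int W) \<and> hilbert_cube m D k \<subseteq> B)"
  using assms
proof (induction k arbitrary: \<eta>)
  case 0
  show ?case
  proof (rule exI[of _ 0], rule exI[of _ 1], intro allI impI)
    fix N :: nat and B :: "int set"
    assume "1 \<le> N" "B \<subseteq> {0..<int N}" "\<eta> * real N \<le> real (card B)"
    with 0 have "B \<noteq> {}" by (auto simp: mult_le_0_iff)
    then show "\<exists>m D. (\<forall>i<0. 1 \<le> D i \<and> D i \<le> int 0) \<and> hilbert_cube m D 0 \<subseteq> B" by auto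
  qed
next
  case (Suc k)
  obtain t N1 and \<eta>' :: real where t: "\<eta>' > 0" "\<And>N B. N \<ge> N1 \<Longrightarrow> B \<subseteq> {0..<int N} \<Longrightarrow> \<eta> * real N \<le> real (card B) \<Longrightarrow>
           \<exists>d. 1 \<le> d \<and> d \<le> int t \<and> \<eta>' * real N \<le> real (card {x \<in> B. x + d \<in> B})"
    using popular_small_difference[OF Suc.prems] by metis
  obtain W N2 where W: "\<And>N B. N \<ge> N2 \<Longrightarrow> B \<subseteq> {0..<int N} \<Longrightarrow> \<eta>' * real N \<le> real (card B) \<Longrightarrow>
           \<exists>m D. (\<forall>i<k. 1 \<le> D i \<and> D i \<le> int W) \<and> hilbert_cube m D k \<subseteq> B"
    using Suc.IH[OF t(1)] by metis
  show ?case
  proof (rule exI[of _ "max t W"], rule exI[of _ "max N1 N2"], intro allI impI)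
    fix N :: nat and B :: "int set" assume N: "max N1 N2 \<le> N" and B: "B \<subseteq> {0..<int N}" "\<eta> * real N \<le> real (card B)"
    obtain d where d: "1 \<le> d" "d \<le> int t" "\<eta>' * real N \<le> real (card {x \<in> B. x + d \<in> B})"
      using t(2)[OF _ B] N by auto
    obtain m D where D: "\<And>i. i < k \<Longrightarrow> 1 \<le> D i \<and> D i \<le> int W" "hilbert_cube m D k \<subseteq> {x \<in> B. x + d \<in> B}"
      using W[OF _ _ d(3)] N B by (smt (verit) max.bounded_iff mem_Collect_eq subset_eq)
    have "hilbert_cube m (D(k := d)) k = hilbert_cube m D k" by (rule hilbert_cube_cong) simp
    then have "hilbert_cube m (D(k := d)) (Suc k) \<subseteq> B" using D(2) by auto
    moreover have "\<forall>i<Suc k. 1 \<le> (D(k := d)) i \<and> (D(k := d)) i \<le> int (max t W)"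
      using D(1) d by (auto simp: less_Suc_eq max_def) force+
    ultimately show "\<exists>m D. (\<forall>i<Suc k. 1 \<le> D i \<and> D i \<le> int (max t W)) \<and> hilbert_cube m D (Suc k) \<subseteq> B"
      by blast
  qed
qed

text \<open>
  Szemeredi's combinatorial argument. A set \<open>A\<close> of nearly maximal density contains a Hilbert cube
  with bounded steps. The weighted means of points of \<open>A\<close> with the members of the subcubes of growing
  dimension form an increasing chain of sets of positive density disjoint from \<open>A\<close>, so two consecutive
  ones nearly agree; such a set is nearly invariant under a bounded shift \<open>\<Delta>\<close>, and its complement is
  a union of few progressions with difference \<open>\<Delta>\<close>. On these \<open>A\<close> cannot be much denser than the limit
  density, which leaves too little room for \<open>A\<close>.
\<close>

lemma no_positive_limit_density:
  fixes a b :: int and d :: real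
  assumes ab: "a > 0" "b > 0" and d: "d > 0"
    and lower: "\<And>N. \<exists>A\<subseteq>{0..<int N}. weighted_mean_free a b A \<and> d * real N \<le> real (card A)"
    and upper: "\<And>e. e > d \<Longrightarrow> \<exists>L\<ge>1. \<forall>C\<subseteq>{0..<int L}. weighted_mean_free a b C \<longrightarrow> real (card C) \<le> e * real L"
  shows False
proof -
  define q where "q = a + b"
  have q: "q > 0" unfolding q_def using ab by simp
  \<comment> \<open>Chosen so that \<open>d * \<eta> = 4 * \<theta>\<close>: replacing
    \<open>d\<close> by \<open>e\<close> costs \<open>2 * \<theta>\<close>, the errors at the end
    another \<open>2 * \<theta>\<close>, and removing a set of density about \<open>\<eta>\<close>
    wins this back with \<open>2 * \<theta> * \<eta>\<close> to spare.\<close>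
  define \<theta> where "\<theta> = d\<^sup>2 / (4 * real_of_int q)"
  have \<theta>: "\<theta> > 0" unfolding \<theta>_def using d q by simp
  define e where "e = d + 2 * \<theta>"
  have e: "e > d" "e > 0" unfolding e_def using \<theta> d by auto
  obtain L where L: "L \<ge> 1" "\<And>C. C \<subseteq> {0..<int L} \<Longrightarrow> weighted_mean_free a b C \<Longrightarrow> real (card C) \<le> e * real L"
    using upper[OF e(1)] by blast
  obtain k0 :: nat where k0: "real k0 \<ge> real L / \<theta>" using real_arch_simple by blast
  \<comment> \<open>An increment of at most \<open>N / k\<close> in the chain then costs at most
    \<open>\<theta> * N\<close> after the factor \<open>L\<close>.\<close>
  define k where "k = Suc k0"
  have k: "real L \<le> \<theta> * real k"
    using k0 \<theta> unfolding k_def by (simp add: field_simps)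
  define \<eta> where "\<eta> = d / real_of_int q"
  have \<eta>: "\<eta> > 0" unfolding \<eta>_def using d q by simp
  obtain W N0 where W: "\<And>N B. N \<ge> N0 \<Longrightarrow> B \<subseteq> {0..<int N} \<Longrightarrow> \<eta> * real N \<le> real (card B) \<Longrightarrow>
           \<exists>m D. (\<forall>i<k. 1 \<le> D i \<and> D i \<le> int W) \<and> hilbert_cube m D k \<subseteq> B"
    using dense_contains_hilbert_cube[OF \<eta>, of k] by metis
  \<comment> \<open>The errors independent of \<open>N\<close>: at most \<open>2 ^ k\<close> cube
    points taken out of the residue class, and the starts among the first
    \<open>\<Delta> \<le> b * W\<close> points.\<close>
  define K where "K = e * 2 ^ k + real L * (of_int b * real W)"
  obtain N1 :: nat where N1: "real N1 > K / \<theta>" using reals_Archimedean2 by blast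
  define N where "N = max N0 N1"
  have N: "N \<ge> N0" "K < \<theta> * real N"
    using N1 \<theta> unfolding N_def by (auto simp: field_simps max_def split: if_splits)
       (smt (verit, best) mult_left_mono of_nat_le_iff)+
  obtain A where A: "A \<subseteq> {0..<int N}" "weighted_mean_free a b A" "d * real N \<le> real (card A)"
    using lower by blast
  have finA: "finite A" using A(1) finite_subset by blast
  \<comment> \<open>Within one residue class modulo \<open>q = a + b\<close> all weighted means are
    integers, and the step \<open>D i\<close> chosen later is divisible by \<open>q\<close>.\<close>
  define Ar where "Ar r = {x \<in> A. x mod q = r}" for r
  have "\<exists>r\<in>{0..<q}. \<eta> * real N \<le> real (card (Ar r))"
  proof (rule ccontr)
    assume "\<not> ?thesis"
    then have lt: "\<And>r. r \<in> {0..<q} \<Longrightarrow> real (card (Ar r)) < \<eta> * real N" by force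
    have "A = (\<Union>r\<in>{0..<q}. Ar r)" unfolding Ar_def using q by auto
    then have "card A \<le> (\<Sum>r\<in>{0..<q}. card (Ar r))"
      by (metis card_UN_le finite_atLeastLessThan_int)
    then have "real (card A) \<le> (\<Sum>r\<in>{0..<q}. real (card (Ar r)))"
      by (metis of_nat_le_iff of_nat_sum)
    also have "\<dots> < (\<Sum>r\<in>{0..<q}. \<eta> * real N)"
      by (rule sum_strict_mono) (use lt q in auto)
    also have "\<dots> = d * real N" unfolding \<eta>_def using q by simp
    finally show False using A(3) by simp
  qed
  then obtain r where r: "\<eta> * real N \<le> real (card (Ar r))" by blast
  have ArA: "Ar r \<subseteq> A" unfolding Ar_def by auto
  obtain m D where D: "\<And>i. i < k \<Longrightarrow> 1 \<le> D i \<and> D i \<le> int W" "hilbert_cube m D k \<subseteq> Ar r"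
    using W[OF N(1) _ r] ArA A(1) by (metis subset_trans)
  define H where "H = hilbert_cube m D"
  have H_Ar: "H i \<subseteq> Ar r" if "i \<le> k" for i
    using D(2) hilbert_cube_mono[OF that] unfolding H_def by blast
  define f where "f = (\<lambda>(x, h). (a * x + b * h) div q)"
  have f: "q * f (x, h) = a * x + b * h" if "x \<in> Ar r" "h \<in> Ar r" for x h
  proof -
    have "x mod q = h mod q" using that unfolding Ar_def by simp
    then have "q dvd a * (x - h)" by (simp add: mod_eq_dvd_iff)
    then have "q dvd a * (x - h) + q * h" by simp
    then have "q dvd a * x + b * h" by (simp add: q_def algebra_simps)
    then show ?thesis by (simp add: f_def)
  qed
  \<comment> \<open>Taking \<open>x\<close> outside the full cube keeps \<open>x \<noteq> h\<close>,
    so the mean cannot lie in the mean-free set \<open>A\<close>.\<close>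
  define Nb where "Nb i = f ` ((Ar r - H k) \<times> H i)" for i
  have Nb_sub: "Nb i \<subseteq> {0..<int N} - A" if "i \<le> k" for i
  proof
    fix z assume "z \<in> Nb i"
    then obtain x h where xh: "x \<in> Ar r" "x \<notin> H k" "h \<in> H i" and z: "z = f (x, h)"
      unfolding Nb_def by auto
    have h: "h \<in> Ar r" "h \<in> H k"
      using H_Ar[OF that] xh(3) hilbert_cube_mono[OF that, of m D] unfolding H_def by auto
    have eq: "(a + b) * z = a * x + b * h" using f[OF xh(1) h(1)] z q_def by simp
    have xA: "x \<in> A" "h \<in> A" "x \<noteq> h" using xh h ArA by auto
    then have bd: "0 \<le> x" "0 \<le> h" "x \<le> int N - 1" "h \<le> int N - 1" using A(1) by force+
    have "0 \<le> (a + b) * z" unfolding eq using bd ab by simp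
    then have "0 \<le> z" using ab by (simp add: zero_le_mult_iff)
    moreover have "(a + b) * z \<le> (a + b) * (int N - 1)"
      unfolding eq unfolding distrib_right using bd ab by (intro add_mono mult_left_mono) auto
    then have "z \<le> int N - 1" by (rule mult_left_le_imp_le) (use ab in simp)
    moreover have "z \<notin> A" using A(2) xA eq unfolding weighted_mean_free_def by metis
    ultimately show "z \<in> {0..<int N} - A" by auto
  qed
  have finNb: "finite (Nb i)" for i
    unfolding Nb_def H_def using finite_hilbert_cube finA ArA finite_subset by blast
  have Nb_mono: "Nb i \<subseteq> Nb (Suc i)" for i
    unfolding Nb_def H_def by auto
  have Nb0: "\<eta> * real N - 2 ^ k \<le> real (card (Nb i))" for i
  proof -
    have sub: "(\<lambda>x. f (x, m)) ` (Ar r - H k) \<subseteq> Nb i"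
      unfolding Nb_def H_def using hilbert_cube_base by blast
    have "m \<in> Ar r" using H_Ar[of 0] unfolding H_def by simp
    then have "inj_on (\<lambda>x. f (x, m)) (Ar r - H k)"
      using f ab by (intro inj_onI) (metis DiffD1 add_right_cancel less_irrefl mult_cancel_left)
    then have "card (Ar r - H k) \<le> card (Nb i)"
      using card_mono[OF finNb sub] by (simp add: card_image)
    moreover have "card (Ar r) - card (H k) \<le> card (Ar r - H k)"
      unfolding H_def by (rule diff_card_le_card_Diff[OF finite_hilbert_cube])
    moreover have "card (H k) \<le> 2 ^ k" unfolding H_def by (rule card_hilbert_cube)
    ultimately have "card (Ar r) \<le> card (Nb i) + 2 ^ k" by linarith
    then have "real (card (Ar r)) \<le> real (card (Nb i)) + 2 ^ k"
      by (metis of_nat_le_iff of_nat_add of_nat_numeral of_nat_power)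
    then show ?thesis using r by linarith
  qed
  \<comment> \<open>The \<open>k\<close> increments add up to at most \<open>N\<close>, so one of
    them is at most \<open>N / k\<close>.\<close>
  have "\<exists>i<k. k * card (Nb (Suc i) - Nb i) \<le> N"
  proof (rule ccontr)
    assume neg: "\<not> ?thesis"
    have "(\<Sum>i<n. card (Nb (Suc i) - Nb i)) \<le> card (Nb n)" for n
    proof (induction n)
      case (Suc n)
      have "card (Nb (Suc n)) = card (Nb n) + card (Nb (Suc n) - Nb n)"
        using card_Diff_subset[OF finNb Nb_mono] card_mono[OF finNb Nb_mono] by simp
      then show ?case using Suc by simp
    qed simp
    also have "card (Nb k) \<le> card {0..<int N}"
      using Nb_sub[of k] by (intro card_mono) auto
    finally have *: "(\<Sum>i<k. card (Nb (Suc i) - Nb i)) \<le> N" by simp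
    have "(\<Sum>i<k. N) < (\<Sum>i<k. k * card (Nb (Suc i) - Nb i))"
      by (rule sum_strict_mono) (use neg in \<open>auto simp: k_def not_le\<close>)
    also have "\<dots> = k * (\<Sum>i<k. card (Nb (Suc i) - Nb i))" by (simp add: sum_distrib_left)
    also have "\<dots> \<le> k * N" using * by simp
    finally show False by simp
  qed
  then obtain i where i: "i < k" "k * card (Nb (Suc i) - Nb i) \<le> N" by blast
  \<comment> \<open>Moving \<open>h\<close> by \<open>D i\<close> moves its weighted mean with a
    fixed \<open>x\<close> by this amount.\<close>
  define \<Delta> where "\<Delta> = b * D i div q"
  have mAr: "m \<in> Ar r" "m + D i \<in> Ar r"
    using H_Ar[of "Suc i"] i(1) hilbert_cube_base[of m D i] unfolding H_def by auto
  then have "(m + D i) mod q = m mod q" unfolding Ar_def by simp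
  then have "q dvd D i" using mod_eq_dvd_iff[of "m + D i" q m] by simp
  then have \<Delta>: "q * \<Delta> = b * D i" unfolding \<Delta>_def by simp
  have Di: "1 \<le> D i" "D i \<le> int W" using D(1)[OF i(1)] by auto
  have "0 < q * \<Delta>" unfolding \<Delta> using ab Di by simp
  then have \<Delta>1: "\<Delta> \<ge> 1" using q by (simp add: zero_less_mult_iff)
  then have "\<Delta> \<le> q * \<Delta>" using q by (simp add: mult_le_cancel_right1)
  also have "\<dots> \<le> b * int W" unfolding \<Delta> using ab Di by simp
  finally have \<Delta>W: "\<Delta> \<le> b * int W" .
  have shift: "y + \<Delta> \<in> Nb (Suc i)" if "y \<in> Nb i" for y
  proof -
    obtain x h where xh: "x \<in> Ar r - H k" "h \<in> H i" "y = f (x, h)" using \<open>y \<in> Nb i\<close> unfolding Nb_def by auto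
    have h': "h + D i \<in> H (Suc i)" using xh(2) unfolding H_def by auto
    have "h \<in> Ar r" "h + D i \<in> Ar r" using H_Ar[of i] H_Ar[of "Suc i"] h' xh(2) i(1) by auto
    then have "q * f (x, h + D i) = q * (y + \<Delta>)"
      using f xh \<Delta> by (simp add: algebra_simps)
    then have "y + \<Delta> = f (x, h + D i)" using q by simp
    then show ?thesis unfolding Nb_def using xh(1) h' by blast
  qed
  define M where "M = {0..<int N} - Nb i"
  have finM: "finite M" unfolding M_def by simp
  have AM: "A \<inter> M = A" unfolding M_def using A(1) Nb_sub[of i] i(1) by auto
  \<comment> \<open>If \<open>y - \<Delta>\<close> leaves \<open>M\<close>, it is negative or in
    \<open>Nb i\<close>; the latter puts \<open>y\<close> in \<open>Nb (Suc i)\<close> by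
    \<open>shift\<close>.\<close>
  have "card {y \<in> M. y - \<Delta> \<notin> M} \<le> card ({0..<\<Delta>} \<union> (Nb (Suc i) - Nb i))"
  proof (rule card_mono)
    show "{y \<in> M. y - \<Delta> \<notin> M} \<subseteq> {0..<\<Delta>} \<union> (Nb (Suc i) - Nb i)"
      unfolding M_def using shift \<Delta>1 by fastforce
  qed (use finNb in auto)
  also have "\<dots> \<le> card {0..<\<Delta>} + card (Nb (Suc i) - Nb i)" by (rule card_Un_le)
  finally have "real (card {y \<in> M. y - \<Delta> \<notin> M}) \<le> of_int \<Delta> + real (card (Nb (Suc i) - Nb i))"
    using \<Delta>1 by (simp add: nat_le_eq_zle of_nat_le_iff[symmetric, where 'a = real] del: of_nat_le_iff)
  moreover have "of_int \<Delta> \<le> of_int b * real W"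
    using \<Delta>W by (metis of_int_le_iff of_int_mult of_int_of_nat_eq)
  ultimately have starts: "real L * real (card {y \<in> M. y - \<Delta> \<notin> M})
      \<le> real L * (of_int b * real W) + real L * real (card (Nb (Suc i) - Nb i))"
    by (smt (verit) distrib_left mult_left_mono of_nat_0_le_iff)
  have "real L * real (card (Nb (Suc i) - Nb i)) \<le> \<theta> * real k * real (card (Nb (Suc i) - Nb i))"
    using k by (rule mult_right_mono) simp
  also have "\<dots> = \<theta> * real (k * card (Nb (Suc i) - Nb i))" by simp
  also have "\<dots> \<le> \<theta> * real N" using i(2) \<theta> by (intro mult_left_mono of_nat_mono) auto
  finally have gain: "real L * real (card (Nb (Suc i) - Nb i)) \<le> \<theta> * real N" .
  have "card M = N - card (Nb i)"
    unfolding M_def using Nb_sub[of i] i(1) finNb by (subst card_Diff_subset) auto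
  moreover have "card (Nb i) \<le> N"
    using card_mono[of "{0..<int N}" "Nb i"] Nb_sub[of i] i(1) by auto
  ultimately have "real (card M) \<le> real N - \<eta> * real N + 2 ^ k"
    using Nb0[of i] by (simp add: of_nat_diff)
  then have "e * real (card M) \<le> e * (real N - \<eta> * real N + 2 ^ k)"
    using e by (intro mult_left_mono) auto
  moreover have "d * real N \<le> e * real (card M) + real L * real (card {y \<in> M. y - \<Delta> \<notin> M})"
    using card_Int_le_starts[OF L less_imp_le[OF e(2)] \<Delta>1 A(2) finM] A(3) unfolding AM by linarith
  ultimately have "d * real N \<le> e * (real N - \<eta> * real N) + K + \<theta> * real N"
    using starts gain unfolding K_def by (simp add: algebra_simps)
  also have "\<dots> < e * (real N - \<eta> * real N) + 2 * \<theta> * real N" using N(2) by simp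
  finally have "d * real N < (e * (1 - \<eta>) + 2 * \<theta>) * real N" by (simp add: algebra_simps)
  then have "d < e * (1 - \<eta>) + 2 * \<theta>" by (simp add: mult_less_cancel_right)
  moreover have "d * \<eta> = 4 * \<theta>" unfolding \<eta>_def \<theta>_def by (simp add: power2_eq_square)
  moreover have "\<theta> * \<eta> > 0" using \<theta> \<eta> by simp
  ultimately show False unfolding e_def by (simp add: algebra_simps)
qed

text \<open>The infimum of the extremal densities bounds all of them from below and is approached,
  so \<open>no_positive_limit_density\<close> shows that it is not positive. Hence some length
  \<open>L\<close> has extremal density at most \<open>\<delta> / 2\<close>, which long intervals
  inherit up to one remainder.\<close>

lemma roth_weighted_mean:
  fixes a b :: int and \<delta> :: real
  assumes ab: "a > 0" "b > 0" and \<delta>: "\<delta> > 0"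
  shows "\<exists>N0. \<forall>N\<ge>N0. \<forall>A\<subseteq>{0..<int N}. \<delta> * real N \<le> real (card A) \<longrightarrow> \<not> weighted_mean_free a b A"
proof -
  define F where "F N = card ` {B. B \<subseteq> {0..<int N} \<and> weighted_mean_free a b B}" for N
  define r where "r N = Max (F N)" for N
  have finF: "finite (F N)" for N unfolding F_def by simp
  have "weighted_mean_free a b {}" unfolding weighted_mean_free_def by simp
  then have Fne: "F N \<noteq> {}" for N unfolding F_def by blast
  have r_upper: "card C \<le> r N" if "C \<subseteq> {0..<int N}" "weighted_mean_free a b C" for C N
    unfolding r_def by (rule Max_ge[OF finF]) (use that in \<open>auto simp: F_def\<close>)
  have r_attained: "\<exists>A\<subseteq>{0..<int N}. weighted_mean_free a b A \<and> card A = r N" for N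
    using Max_in[OF finF Fne, of N] unfolding r_def by (auto simp: F_def)
  define d where "d = (INF N\<in>{1..}. real (r N) / real N)"
  have bdd: "bdd_below ((\<lambda>N. real (r N) / real N) ` {1..})"
    by (rule bdd_belowI[of _ 0]) auto
  have d_le: "d * real N \<le> real (r N)" for N
  proof (cases "N = 0")
    case False
    then have "d \<le> real (r N) / real N" unfolding d_def by (intro cINF_lower[OF bdd]) auto
    with False show ?thesis by (simp add: field_simps)
  qed simp
  have upper: "\<exists>L\<ge>1. \<forall>C\<subseteq>{0..<int L}. weighted_mean_free a b C \<longrightarrow> real (card C) \<le> e * real L" if "e > d" for e
  proof -
    obtain L where L: "L \<ge> 1" "real (r L) / real L < e"
      using \<open>e > d\<close> unfolding d_def using cINF_less_iff[OF _ bdd, of e] by auto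
    then have "real (r L) \<le> e * real L" by (simp add: field_simps)
    with L(1) show ?thesis using r_upper by (meson of_nat_le_iff order_trans)
  qed
  have "\<not> d > 0"
  proof
    assume "d > 0"
    show False
    proof (rule no_positive_limit_density[OF ab \<open>d > 0\<close> _ upper])
      show "\<exists>A\<subseteq>{0..<int N}. weighted_mean_free a b A \<and> d * real N \<le> real (card A)" for N
        using r_attained[of N] d_le[of N] by metis
    qed
  qed
  then have "\<delta> / 2 > d" using \<delta> by simp
  then obtain L where L: "L \<ge> 1" "\<And>C. C \<subseteq> {0..<int L} \<Longrightarrow> weighted_mean_free a b C \<Longrightarrow> real (card C) \<le> \<delta> / 2 * real L"
    using upper by blast
  obtain N0 :: nat where N0: "real N0 > 2 * real L / \<delta>" using reals_Archimedean2 by blast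
  show ?thesis
  proof (intro exI[of _ N0] allI impI notI)
    fix N A assume N: "N0 \<le> N" and A: "A \<subseteq> {0..<int N}" "\<delta> * real N \<le> real (card A)" "weighted_mean_free a b A"
    have N1: "N > 0" using N0 N \<delta> by (cases N) (auto simp: divide_less_0_iff)
    have "A \<inter> {0..<int N} = A" using A(1) by auto
    \<comment> \<open>An interval is one progression of difference 1, so the loss is a single
      \<open>L\<close>, below \<open>\<delta> * N / 2\<close> by the choice of
      \<open>N0\<close>.\<close>
    moreover have "{y \<in> {0..<int N}. y - 1 \<notin> {0..<int N}} = {0}" using N1 by auto
    ultimately have "real (card A) \<le> \<delta> / 2 * real N + real L"
      using card_Int_le_starts[OF L _ order_refl A(3), of "{0..<int N}"] \<delta> by simp
    moreover have "2 * real L < \<delta> * real N"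
      using N0 N \<delta> by (smt (verit) mult_le_cancel_left_pos of_nat_le_iff pos_divide_less_eq mult.commute)
    ultimately show False using A(2) by simp
  qed
qed

text \<open>Two of the three coefficients have the same sign; rotation and a change of sign lead to
  \<open>u * x + v * y = (u + v) * z\<close> with \<open>u\<close>, \<open>v\<close> positive, where
  \<open>x \<noteq> y\<close> makes all three values distinct.\<close>

lemma roth_three_variables:
  fixes a b c :: int and \<delta> :: real
  assumes "a \<noteq> 0" "b \<noteq> 0" "c \<noteq> 0" "a + b + c = 0" and \<delta>: "\<delta> > 0"
  shows "\<exists>N0. \<forall>N\<ge>N0. \<forall>A\<subseteq>{0..<int N}. \<delta> * real N \<le> real (card A) \<longrightarrow>
           (\<exists>x\<in>A. \<exists>y\<in>A. \<exists>z\<in>A. x \<noteq> y \<and> x \<noteq> z \<and> y \<noteq> z \<and> a * x + b * y + c * z = 0)"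
proof -
  define sol where "sol u v w A \<longleftrightarrow>
      (\<exists>x\<in>A. \<exists>y\<in>A. \<exists>z\<in>A. x \<noteq> y \<and> x \<noteq> z \<and> y \<noteq> z \<and> u * x + v * y + w * z = 0)"
    for u v w :: int and A
  have pos: "\<exists>N0. \<forall>N\<ge>N0. \<forall>A\<subseteq>{0..<int N}. \<delta> * real N \<le> real (card A) \<longrightarrow> sol u v w A"
    if uv: "u > 0" "v > 0" "w = - (u + v)" for u v w
  proof -
    have "sol u v w A" if "\<not> weighted_mean_free u v A" for A
    proof -
      obtain x y z where xyz: "x \<in> A" "y \<in> A" "z \<in> A" "x \<noteq> y" "u * x + v * y = (u + v) * z"
        using \<open>\<not> weighted_mean_free u v A\<close> unfolding weighted_mean_free_def by blast
      then have "u * (x - z) = v * (z - y)" by (simp add: algebra_simps)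
      then have "x \<noteq> z \<and> y \<noteq> z" using xyz(4) uv by auto
      moreover have "u * x + v * y + w * z = 0" unfolding uv(3) using xyz(5) by (simp add: algebra_simps)
      ultimately show ?thesis unfolding sol_def using xyz by blast
    qed
    with roth_weighted_mean[OF uv(1,2) \<delta>] show ?thesis by meson
  qed
  have same_sign: "\<exists>N0. \<forall>N\<ge>N0. \<forall>A\<subseteq>{0..<int N}. \<delta> * real N \<le> real (card A) \<longrightarrow> sol u v w A"
    if "u * v > 0" "w = - (u + v)" for u v w
  proof (cases "u > 0")
    case True
    with that pos show ?thesis by (simp add: zero_less_mult_iff)
  next
    case False
    with that have "- u > 0" "- v > 0" "- w = - (- u + - v)" by (auto simp: zero_less_mult_iff)
    moreover have "sol (- u) (- v) (- w) = sol u v w"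
    proof -
      have "- u * x + - v * y + - w * z = 0 \<longleftrightarrow> u * x + v * y + w * z = 0" for x y z by auto
      then show ?thesis unfolding sol_def by presburger
    qed
    ultimately show ?thesis using pos[of "- u" "- v" "- w"] by simp
  qed
  have rot: "sol u v w A \<Longrightarrow> sol w u v A" for u v w A
  proof -
    assume "sol u v w A"
    then obtain x y z where "x \<in> A" "y \<in> A" "z \<in> A" "x \<noteq> y" "x \<noteq> z" "y \<noteq> z" "w * z + u * x + v * y = 0"
      unfolding sol_def by (auto simp: algebra_simps)
    then show "sol w u v A" unfolding sol_def by metis
  qed
  have c: "c = - (a + b)" "b = - (c + a)" "a = - (b + c)" using assms(4) by auto
  have "a * b > 0 \<or> b * c > 0 \<or> c * a > 0"
    using assms(1-3) by (auto simp: zero_less_mult_iff)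
  then have "\<exists>N0. \<forall>N\<ge>N0. \<forall>A\<subseteq>{0..<int N}. \<delta> * real N \<le> real (card A) \<longrightarrow> sol a b c A"
    using same_sign[OF _ c(1)] same_sign[OF _ c(2)] same_sign[OF _ c(3)] rot by meson
  then show ?thesis unfolding sol_def .
qed

subsection \<open>Translation-invariant equations in several variables\<close>

text \<open>Solutions are over the integers; as residues are represented in
  \<open>{0..<int p}\<close>, they also solve the equation modulo \<open>p\<close>.\<close>

definition solvable_in_dense_sets :: "('i \<Rightarrow> int) \<Rightarrow> 'i set \<Rightarrow> bool" where
  "solvable_in_dense_sets c I \<longleftrightarrow>
     (\<forall>\<delta>::real. \<delta> > 0 \<longrightarrow> (\<exists>N0. \<forall>N\<ge>N0. \<forall>A\<subseteq>{0..<int N}. \<delta> * real N \<le> real (card A) \<longrightarrow>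
        (\<exists>x. inj_on x I \<and> x ` I \<subseteq> A \<and> (\<Sum>i\<in>I. c i * x i) = 0)))"

text \<open>
  Injectivity is only required on \<open>I - {i}\<close>, so that the value \<open>z\<close> may be repeated; in this way
  the notion also makes sense for \<open>x - y = 0\<close>, where every \<open>z\<close> is extendable.
\<close>

definition extendable :: "('i \<Rightarrow> int) \<Rightarrow> 'i set \<Rightarrow> 'i \<Rightarrow> nat \<Rightarrow> int set \<Rightarrow> int \<Rightarrow> bool" where
  "extendable c I i K A z \<longleftrightarrow>
     (\<forall>F. finite F \<and> card F \<le> K \<and> z \<notin> F \<longrightarrow>
        (\<exists>y. inj_on y (I - {i}) \<and> y ` (I - {i}) \<subseteq> A - F \<and> c i * z + (\<Sum>s\<in>I - {i}. c s * y s) = 0))"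

text \<open>Each nonextendable \<open>z\<close> has a forbidden set \<open>F z\<close> admitting no
  extension. If there were many such \<open>z\<close>, the digraph lemma would give a dense set of
  them in which none lies in the forbidden set of another. A solution inside it, with value
  \<open>z\<close> at \<open>i\<close>, extends \<open>z\<close> while avoiding
  \<open>F z\<close>.\<close>

lemma few_nonextendable:
  fixes \<delta> :: real
  assumes I: "finite I" "i \<in> I" "solvable_in_dense_sets c I" and \<delta>: "\<delta> > 0"
  shows "\<exists>N0. \<forall>N\<ge>N0. \<forall>A\<subseteq>{0..<int N}. real (card {z \<in> A. \<not> extendable c I i K A z}) \<le> \<delta> * real N"
proof -
  define \<delta>' where "\<delta>' = \<delta> / real (2 * K + 1)"
  have "\<delta>' > 0" unfolding \<delta>'_def using \<delta> by simp
  then obtain N0 where N0: "\<And>N A. N \<ge> N0 \<Longrightarrow> A \<subseteq> {0..<int N} \<Longrightarrow> \<delta>' * real N \<le> real (card A) \<Longrightarrow>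
        \<exists>x. inj_on x I \<and> x ` I \<subseteq> A \<and> (\<Sum>i\<in>I. c i * x i) = 0"
    using I(3) unfolding solvable_in_dense_sets_def by meson
  show ?thesis
  proof (rule exI[of _ N0], intro allI impI, rule ccontr)
    fix N :: nat and A assume N: "N0 \<le> N" and A: "A \<subseteq> {0..<int N}"
    define B where "B = {z \<in> A. \<not> extendable c I i K A z}"
    assume "\<not> real (card {z \<in> A. \<not> extendable c I i K A z}) \<le> \<delta> * real N"
    then have big: "\<delta> * real N \<le> real (card B)" unfolding B_def by simp
    have finB: "finite B" unfolding B_def using finite_subset[OF A] by simp
    define E where "E z F \<longleftrightarrow>
        (\<exists>y. inj_on y (I - {i}) \<and> y ` (I - {i}) \<subseteq> A - F \<and> c i * z + (\<Sum>s\<in>I - {i}. c s * y s) = 0)"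
      for z F
    have "\<exists>F. finite F \<and> card F \<le> K \<and> z \<notin> F \<and> \<not> E z F" if "z \<in> B" for z
    proof -
      have "\<not> (\<forall>F. finite F \<and> card F \<le> K \<and> z \<notin> F \<longrightarrow> E z F)"
        using that unfolding B_def extendable_def E_def by simp
      then show ?thesis by blast
    qed
    then obtain F where F: "\<And>z. z \<in> B \<Longrightarrow> finite (F z) \<and> card (F z) \<le> K"
      "\<And>z. z \<in> B \<Longrightarrow> \<not> E z (F z)"
      by metis
    have "\<exists>U\<subseteq>B. card B \<le> (2 * K + 1) * card U \<and> (\<forall>u\<in>U. \<forall>v\<in>U. u \<noteq> v \<longrightarrow> v \<notin> F u)"
      by (rule sparse_digraph_independent_set[OF finB]) (rule F(1))
    then obtain U where U: "U \<subseteq> B" "card B \<le> (2 * K + 1) * card U" "\<forall>u\<in>U. \<forall>v\<in>U. u \<noteq> v \<longrightarrow> v \<notin> F u"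
      by blast
    have "real (card B) \<le> real ((2 * K + 1) * card U)" using U(2) by (rule of_nat_mono)
    then have "\<delta> * real N \<le> real (2 * K + 1) * real (card U)" using big by (simp only: of_nat_mult)
    then have "\<delta>' * real N \<le> real (card U)" unfolding \<delta>'_def by (simp add: field_simps)
    moreover have UA: "U \<subseteq> A" using U(1) unfolding B_def by auto
    ultimately obtain x where x: "inj_on x I" "x ` I \<subseteq> U" "(\<Sum>i\<in>I. c i * x i) = 0"
      using N0[OF N subset_trans[OF UA A]] by blast
    have xi: "x i \<in> U" using x(2) I(2) by auto
    have "x ` (I - {i}) \<subseteq> A - F (x i)"
    proof (intro image_subsetI)
      fix s assume s: "s \<in> I - {i}"
      then have "x s \<noteq> x i" using x(1) I(2) by (auto simp: inj_on_def)
      moreover have "x s \<in> U" using x(2) s by auto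
      ultimately show "x s \<in> A - F (x i)" using U(3) UA xi by auto
    qed
    moreover have "inj_on x (I - {i})" using x(1) by (rule inj_on_subset) auto
    moreover have "c i * x i + (\<Sum>s\<in>I - {i}. c s * x s) = 0"
      using x(3) sum.remove[OF I(1,2), of "\<lambda>s. c s * x s"] by simp
    ultimately have "E (x i) (F (x i))" unfolding E_def by blast
    then show False using F(2) xi U(1) by blast
  qed
qed

text \<open>
  Two variables \<open>x\<close>, \<open>y\<close> with \<open>c\<^sub>i + c\<^sub>j \<noteq> 0\<close> are merged into a single one \<open>z\<close> with
  \<open>c\<^sub>i x + c\<^sub>j y = (c\<^sub>i + c\<^sub>j) z\<close>; such a pair exists, as three nonzero numbers do not all cancel in pairs.
\<close>

lemma roth_linear_equation:
  fixes c :: "'i \<Rightarrow> int"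
  assumes "finite I" "card I \<ge> 3" "\<forall>i\<in>I. c i \<noteq> 0" "(\<Sum>i\<in>I. c i) = 0"
  shows "solvable_in_dense_sets c I"
  using assms
proof (induction "card I" arbitrary: I c rule: less_induct)
  case less
  show ?case
  proof (cases "card I = 3")
    case True
    then obtain i j l where ijl: "I = {i, j, l}" "i \<noteq> j" "i \<noteq> l" "j \<noteq> l"
      by (auto simp: card_3_iff)
    have nz: "c i \<noteq> 0" "c j \<noteq> 0" "c l \<noteq> 0" and sum0: "c i + c j + c l = 0"
      using less.prems ijl by auto
    show ?thesis
      unfolding solvable_in_dense_sets_def
    proof (intro allI impI)
      fix \<delta> :: real assume "\<delta> > 0"
      from roth_three_variables[OF nz sum0 this] obtain N0 where N0:
        "\<And>N A. N \<ge> N0 \<Longrightarrow> A \<subseteq> {0..<int N} \<Longrightarrow> \<delta> * real N \<le> real (card A) \<Longrightarrow>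
           (\<exists>x\<in>A. \<exists>y\<in>A. \<exists>z\<in>A. x \<noteq> y \<and> x \<noteq> z \<and> y \<noteq> z \<and> c i * x + c j * y + c l * z = 0)"
        by meson
      show "\<exists>N0. \<forall>N\<ge>N0. \<forall>A\<subseteq>{0..<int N}. \<delta> * real N \<le> real (card A) \<longrightarrow>
          (\<exists>x. inj_on x I \<and> x ` I \<subseteq> A \<and> (\<Sum>i\<in>I. c i * x i) = 0)"
      proof (rule exI[of _ N0], intro allI impI)
        fix N :: nat and A assume "N0 \<le> N" "A \<subseteq> {0..<int N}" "\<delta> * real N \<le> real (card A)"
        from N0[OF this] obtain x y z where xyz: "x \<in> A" "y \<in> A" "z \<in> A"
          "x \<noteq> y" "x \<noteq> z" "y \<noteq> z" "c i * x + c j * y + c l * z = 0" by blast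
        then show "\<exists>x. inj_on x I \<and> x ` I \<subseteq> A \<and> (\<Sum>i\<in>I. c i * x i) = 0"
          using ijl by (intro exI[of _ "\<lambda>s. if s = i then x else if s = j then y else z"]) auto
      qed
    qed
  next
    case False
    have "\<exists>i\<in>I. \<exists>j\<in>I. i \<noteq> j \<and> c i + c j \<noteq> 0"
    proof -
      obtain J where J: "J \<subseteq> I" "card J = 3" using obtain_subset_with_card_n[OF less.prems(2)] by metis
      then obtain i j l where ijl: "J = {i, j, l}" "i \<noteq> j" "i \<noteq> l" "j \<noteq> l" by (auto simp: card_3_iff)
      then have "c i \<noteq> 0" using less.prems(3) J(1) by auto
      then have "c i + c j \<noteq> 0 \<or> c i + c l \<noteq> 0 \<or> c j + c l \<noteq> 0" by linarith
      with ijl J(1) show ?thesis by (metis insert_subset)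
    qed
    then obtain i j where ij: "i \<in> I" "j \<in> I" "i \<noteq> j" "c i + c j \<noteq> 0" by blast
    \<comment> \<open>The index \<open>i\<close> takes over the merged variable, with coefficient
      \<open>c i + c j\<close>.\<close>
    define I' where "I' = I - {j}"
    define c' where "c' = c(i := c i + c j)"
    have I'_i: "I' - {i} = I - {j} - {i}" unfolding I'_def by auto
    have finI': "finite I'" "i \<in> I'" unfolding I'_def using less.prems ij by auto
    have split: "(\<Sum>s\<in>I. g s) = g j + (g i + (\<Sum>s\<in>I' - {i}. g s))" for g :: "'i \<Rightarrow> int"
      using sum.remove[OF less.prems(1) ij(2), of g] sum.remove[OF finI', of g] unfolding I'_def by simp
    have "(\<Sum>s\<in>I' - {i}. c' s) = (\<Sum>s\<in>I' - {i}. c s)" unfolding c'_def by (intro sum.cong) auto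
    then have "(\<Sum>s\<in>I'. c' s) = 0"
      using sum.remove[OF finI', of c'] less.prems(4) split[of c] by (simp add: c'_def)
    moreover have "card I' < card I" "3 \<le> card I'"
      unfolding I'_def using less.prems(1,2) ij(2) False by (auto simp: card_Diff1_less)
    moreover have "\<forall>s\<in>I'. c' s \<noteq> 0" unfolding c'_def I'_def using ij(4) less.prems(3) by auto
    ultimately have IH: "solvable_in_dense_sets c' I'" using less.hyps finI'(1) by blast
    show ?thesis
      unfolding solvable_in_dense_sets_def
    proof (intro allI impI)
      fix \<delta> :: real assume \<delta>: "\<delta> > 0"
      then have \<delta>2: "\<delta> / 2 > 0" by simp
      \<comment> \<open>The two values to be avoided are the \<open>x\<close> and \<open>y\<close>
        into which \<open>z\<close> will be split.\<close>
      obtain N1 where N1: "\<And>N A. N \<ge> N1 \<Longrightarrow> A \<subseteq> {0..<int N} \<Longrightarrow>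
          real (card {z \<in> A. \<not> extendable c' I' i 2 A z}) \<le> \<delta> / 2 * real N"
        using few_nonextendable[OF finI' IH \<delta>2, of 2] by meson
      have nz: "c i \<noteq> 0" "c j \<noteq> 0" "- (c i + c j) \<noteq> 0" "c i + c j + - (c i + c j) = 0"
        using less.prems(3) ij by auto
      obtain N2 where N2:
        "\<And>N A. N \<ge> N2 \<Longrightarrow> A \<subseteq> {0..<int N} \<Longrightarrow> \<delta> / 2 * real N \<le> real (card A) \<Longrightarrow>
           (\<exists>x\<in>A. \<exists>y\<in>A. \<exists>z\<in>A. x \<noteq> y \<and> x \<noteq> z \<and> y \<noteq> z \<and> c i * x + c j * y + - (c i + c j) * z = 0)"
        using roth_three_variables[OF nz \<delta>2] by meson
      show "\<exists>N0. \<forall>N\<ge>N0. \<forall>A\<subseteq>{0..<int N}. \<delta> * real N \<le> real (card A) \<longrightarrow>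
          (\<exists>x. inj_on x I \<and> x ` I \<subseteq> A \<and> (\<Sum>i\<in>I. c i * x i) = 0)"
      proof (rule exI[of _ "max N1 N2"], intro allI impI)
        fix N :: nat and A assume N: "max N1 N2 \<le> N" and A: "A \<subseteq> {0..<int N}" "\<delta> * real N \<le> real (card A)"
        define A1 where "A1 = {z \<in> A. extendable c' I' i 2 A z}"
        have finA: "finite A" using finite_subset[OF A(1)] by simp
        have "card A = card A1 + card {z \<in> A. \<not> extendable c' I' i 2 A z}"
          unfolding A1_def using finA by (subst card_Un_disjoint[symmetric]) (auto intro: arg_cong[where f = card])
        then have "\<delta> / 2 * real N \<le> real (card A1)" using N1[of N A] N A by simp
        moreover have "A1 \<subseteq> {0..<int N}" unfolding A1_def using A(1) by auto
        ultimately obtain x y z where xyz: "x \<in> A1" "y \<in> A1" "z \<in> A1" "x \<noteq> y" "x \<noteq> z" "y \<noteq> z"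
          "c i * x + c j * y + - (c i + c j) * z = 0"
          using N2[of N A1] N by auto
        have "extendable c' I' i 2 A z" using xyz(3) unfolding A1_def by simp
        moreover have "finite {x, y} \<and> card {x, y} \<le> 2 \<and> z \<notin> {x, y}" using xyz(4-6) by simp
        ultimately obtain w where w: "inj_on w (I' - {i})" "w ` (I' - {i}) \<subseteq> A - {x, y}"
          "c' i * z + (\<Sum>s\<in>I' - {i}. c' s * w s) = 0"
          unfolding extendable_def by meson
        \<comment> \<open>\<open>w\<close> avoids \<open>x\<close> and \<open>y\<close>; it may take
          the value \<open>z\<close>, which is harmless because \<open>z\<close> is replaced by
          \<open>x\<close> and \<open>y\<close>.\<close>
        define v where "v = w(i := x, j := y)"
        have v_eq: "v s = w s" if "s \<in> I' - {i}" for s using that unfolding v_def I'_def by auto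
        have vij: "v i = x" "v j = y" unfolding v_def using ij by auto
        have I_eq: "I = insert i (insert j (I' - {i}))" unfolding I'_def using ij by auto
        have "(\<Sum>s\<in>I' - {i}. c s * v s) = (\<Sum>s\<in>I' - {i}. c' s * w s)"
          using v_eq by (intro sum.cong) (auto simp: c'_def)
        then have "(\<Sum>s\<in>I. c s * v s) = c j * y + (c i * x - c' i * z)"
          using split[of "\<lambda>s. c s * v s"] vij w(3) by simp
        also have "\<dots> = 0" using xyz(7) by (simp add: c'_def algebra_simps)
        finally have "(\<Sum>s\<in>I. c s * v s) = 0" .
        moreover have "v ` (I' - {i}) = w ` (I' - {i})" using v_eq by (auto simp: image_iff)
        moreover have "inj_on v (I' - {i})" using w(1) v_eq by (simp add: inj_on_def)
        ultimately have "inj_on v I \<and> v ` I \<subseteq> A \<and> (\<Sum>s\<in>I. c s * v s) = 0"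
          using w(2) vij xyz(1,2,4) ij(3) unfolding I_eq
          by (auto simp: A1_def I'_def)
        then show "\<exists>x. inj_on x I \<and> x ` I \<subseteq> A \<and> (\<Sum>i\<in>I. c i * x i) = 0" by blast
      qed
    qed
  qed
qed

text \<open>Roth's theorem covers three or more indices. One nonzero coefficient cannot sum to zero,
  and two give \<open>c i * (z - y) = 0\<close>, solved by \<open>y = z\<close>, which avoids
  \<open>F\<close>.\<close>

lemma few_nonextendable_zero_sum:
  fixes c :: "'i \<Rightarrow> int" and \<delta> :: real
  assumes "finite I" "i \<in> I" "\<forall>i\<in>I. c i \<noteq> 0" "(\<Sum>i\<in>I. c i) = 0" "\<delta> > 0"
  shows "\<exists>N0. \<forall>N\<ge>N0. \<forall>A\<subseteq>{0..<int N}. real (card {z \<in> A. \<not> extendable c I i K A z}) \<le> \<delta> * real N"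
proof (cases "card I \<ge> 3")
  case True
  from few_nonextendable[OF assms(1,2) roth_linear_equation[OF assms(1) this assms(3,4)] assms(5)]
  show ?thesis .
next
  case False
  have split: "c i + (\<Sum>s\<in>I - {i}. c s) = 0" using sum.remove[OF assms(1,2), of c] assms(4) by simp
  have "card I \<noteq> 0" using assms(1,2) by auto
  moreover have "card I \<noteq> 1" using split assms(2,3) by (auto simp: card_1_singleton_iff)
  ultimately have "card (I - {i}) = 1" using False card_Diff_singleton[OF assms(2)] by linarith
  then obtain j where j: "I - {i} = {j}" by (auto simp: card_1_singleton_iff)
  have "extendable c I i K A z" if "z \<in> A" for A z
    unfolding extendable_def j
  proof (intro allI impI)
    fix F assume "finite F \<and> card F \<le> K \<and> z \<notin> F"
    moreover have "c j = - c i" using split unfolding j by simp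
    ultimately show "\<exists>y. inj_on y {j} \<and> y ` {j} \<subseteq> A - F \<and> c i * z + (\<Sum>s\<in>{j}. c s * y s) = 0"
      using \<open>z \<in> A\<close> by (intro exI[of _ "\<lambda>_. z"]) auto
  qed
  then have "{z \<in> A. \<not> extendable c I i K A z} = {}" for A by blast
  then have "real (card {z \<in> A. \<not> extendable c I i K A z}) \<le> \<delta> * real N" for A N
    using \<open>\<delta> > 0\<close> by (simp only:) simp
  then show ?thesis by blast
qed

subsection \<open>Walks in dilated Cayley graphs\<close>

lemma card_le_independence_number:
  assumes "U \<subseteq> Fp p" and "\<And>u v. u \<in> U \<Longrightarrow> v \<in> U \<Longrightarrow> u \<noteq> v \<Longrightarrow> (v - u) mod int p \<notin> A"
  shows "card U \<le> independence_number (with_proj (cayley_digraph p A))"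
proof -
  have "finite {I. independent_set (with_proj (cayley_digraph p A)) I}"
    by (rule finite_subset[of _ "Pow (Fp p)"])
       (auto simp: independent_set_def cayley_digraph_def Fp_def)
  moreover have "independent_set (with_proj (cayley_digraph p A)) U"
    using assms unfolding independent_set_def parcs_mk_symmetric cayley_digraph_def by auto
  ultimately show ?thesis unfolding independence_number_def by (intro Max_ge) auto
qed

text \<open>Multiplication by \<open>\<alpha> / \<beta>\<close> modulo \<open>p\<close> is injective
  and turns the relation \<open>\<alpha> * (v - u) = \<beta> * w\<close> into a difference
  \<open>w\<close>, so the image of \<open>U\<close> is independent in the Cayley graph of
  \<open>A\<close>.\<close>

lemma dilate_independence_bound:
  fixes p :: nat and \<alpha> \<beta> :: int and M :: real
  assumes p: "prime p" "\<not> int p dvd \<alpha>" "\<not> int p dvd \<beta>"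
    and bound: "\<And>U. U \<subseteq> Fp p \<Longrightarrow> (\<And>u v. u \<in> U \<Longrightarrow> v \<in> U \<Longrightarrow> u \<noteq> v \<Longrightarrow> (v - u) mod int p \<notin> A) \<Longrightarrow>
      real (card U) \<le> M"
    and U: "U \<subseteq> Fp p"
    and indep: "\<And>u v w. u \<in> U \<Longrightarrow> v \<in> U \<Longrightarrow> u \<noteq> v \<Longrightarrow> w \<in> A \<Longrightarrow> \<not> [\<alpha> * (v - u) = \<beta> * w] (mod int p)"
  shows "real (card U) \<le> M"
proof -
  have pp: "prime (int p)" using p(1) by simp
  then have "coprime \<beta> (int p)" using p(3) prime_imp_coprime coprime_commute by blast
  then obtain \<gamma> where \<gamma>: "[\<beta> * \<gamma> = 1] (mod int p)" using cong_solve_coprime_int by blast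
  define g where "g u = (\<gamma> * \<alpha> * u) mod int p" for u
  have key: "[\<beta> * ((g v - g u) mod int p) = \<alpha> * (v - u)] (mod int p)" for u v
  proof -
    have "[\<beta> * ((g v - g u) mod int p) = \<beta> * (\<gamma> * \<alpha> * v - \<gamma> * \<alpha> * u)] (mod int p)"
      unfolding g_def cong_def by (simp add: mod_simps)
    also have "\<beta> * (\<gamma> * \<alpha> * v - \<gamma> * \<alpha> * u) = (\<beta> * \<gamma>) * (\<alpha> * (v - u))" by (simp add: algebra_simps)
    also have "[\<dots> = 1 * (\<alpha> * (v - u))] (mod int p)" by (rule cong_mult[OF \<gamma> cong_refl])
    finally show ?thesis by simp
  qed
  have inj: "inj_on g U"
  proof (rule inj_onI)
    fix u v assume uv: "u \<in> U" "v \<in> U" "g u = g v"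
    then have "int p dvd \<alpha> * (v - u)"
      using key[of v u] by (simp add: cong_def dvd_eq_mod_eq_0)
    then have "int p dvd v - u" using pp p(2) prime_dvd_mult_iff by blast
    then have "v mod int p = u mod int p" by (simp add: mod_eq_dvd_iff)
    then show "u = v" using U uv(1,2) unfolding Fp_def by (metis atLeastLessThan_iff mod_pos_pos_trivial subset_eq)
  qed
  have "real (card (g ` U)) \<le> M"
  proof (rule bound)
    show "g ` U \<subseteq> Fp p" unfolding g_def Fp_def using p(1) prime_gt_0_nat by auto
    fix u' v' assume "u' \<in> g ` U" "v' \<in> g ` U" "u' \<noteq> v'"
    then obtain u v where uv: "u \<in> U" "v \<in> U" "u \<noteq> v" "u' = g u" "v' = g v" by blast
    show "(v' - u') mod int p \<notin> A"
      using indep[OF uv(1-3)] key[of v u] uv(4,5) cong_sym by blast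
  qed
  then show ?thesis by (simp add: card_image[OF inj])
qed

lemma cong_mult_unique:
  assumes "prime p" "\<not> int p dvd \<alpha>" "u \<in> Fp p" "v \<in> Fp p" "[\<alpha> * u = \<alpha> * v] (mod int p)"
  shows "u = v"
proof -
  have "int p dvd \<alpha> * (u - v)" using assms(5) by (simp add: cong_iff_dvd_diff right_diff_distrib)
  then have "int p dvd u - v" using assms(1,2) prime_dvd_mult_iff[of "int p"] by auto
  then have "u mod int p = v mod int p" by (simp add: mod_eq_dvd_iff)
  then show ?thesis using assms(3,4) unfolding Fp_def by simp
qed

lemma card_le_1I: "(\<And>x y. x \<in> A \<Longrightarrow> y \<in> A \<Longrightarrow> x = y) \<Longrightarrow> card A \<le> 1"
  by (metis One_nat_def card.infinite card_le_Suc0_iff_eq le_SucI le_zero_eq)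

text \<open>
  The labels are the starting point \<open>z\<close> and the values \<open>x t\<close>. The last condition excepts the trivial
  walk, which ends where it starts.
\<close>

definition walk_end :: "nat \<Rightarrow> int \<Rightarrow> (nat \<Rightarrow> int) \<Rightarrow> int set \<Rightarrow> int set \<Rightarrow> nat set \<Rightarrow> int \<Rightarrow> bool" where
  "walk_end p \<alpha> c A A1 T z' \<longleftrightarrow>
     (\<exists>z\<in>A1. \<exists>x. inj_on x T \<and> x ` T \<subseteq> A \<and> z \<notin> x ` T \<and>
        [\<alpha> * z' = \<alpha> * z + (\<Sum>t\<in>T. c t * x t)] (mod int p) \<and> (T \<noteq> {} \<longrightarrow> z' \<notin> insert z (x ` T)))"

text \<open>
  If no walk ending in the set \<open>Y\<close> of the proof can be extended within \<open>Y\<close>, then every arc of the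
  next Cayley graph in \<open>Y\<close> carries a label used before or ends in a used label. Such arcs form a
  digraph \<open>G\<close> of bounded out-degree, hence a large part of \<open>Y\<close> is independent. The point \<open>0\<close> is left
  out since otherwise all arcs leaving it could be labelled by their end points.
\<close>

lemma card_non_walk_ends:
  fixes p :: nat and \<alpha> :: int and c :: "nat \<Rightarrow> int" and M :: real
  assumes p: "prime p" "\<not> int p dvd \<alpha>"
    and A: "A \<subseteq> Fp p" "A1 \<subseteq> A - {0}"
    and bound: "\<And>U. U \<subseteq> Fp p \<Longrightarrow> (\<And>u v. u \<in> U \<Longrightarrow> v \<in> U \<Longrightarrow> u \<noteq> v \<Longrightarrow> (v - u) mod int p \<notin> A) \<Longrightarrow>
      real (card U) \<le> M"
    and T: "finite T" "card T \<le> K" "\<And>t. t \<in> T \<Longrightarrow> \<not> int p dvd c t"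
  shows "real (card {z' \<in> A1. \<not> walk_end p \<alpha> c A A1 T z'}) \<le> real (card T) * (real (4 * K + 3) * M)"
  using T
proof (induction T rule: finite_induct)
  case empty
  have "{z' \<in> A1. \<not> walk_end p \<alpha> c A A1 {} z'} = {}"
  proof -
    have "walk_end p \<alpha> c A A1 {} z" if "z \<in> A1" for z
      unfolding walk_end_def using that by (intro bexI[of _ z] exI[of _ id]) auto
    then show ?thesis by blast
  qed
  then show ?case by (simp only:) simp
next
  case (insert t T)
  have finA1: "finite A1" and A1Fp: "A1 \<subseteq> Fp p"
    using A unfolding Fp_def by (auto intro: finite_subset)
  \<comment> \<open>The ends lost on adding the index \<open>t\<close>; it is enough to bound them
    by \<open>(4 * K + 3) * M\<close>.\<close>
  define Y where "Y = {v \<in> A1. walk_end p \<alpha> c A A1 T v \<and> \<not> walk_end p \<alpha> c A A1 (insert t T) v}"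
  have finY: "finite Y" unfolding Y_def using finA1 by simp
  have YFp: "Y \<subseteq> Fp p" unfolding Y_def using A1Fp by auto
  define good where "good u z x \<longleftrightarrow> z \<in> A1 \<and> inj_on x T \<and> x ` T \<subseteq> A \<and> z \<notin> x ` T \<and>
      [\<alpha> * u = \<alpha> * z + (\<Sum>t\<in>T. c t * x t)] (mod int p)" for u z and x :: "nat \<Rightarrow> int"
  have "\<exists>z x. good u z x" if "u \<in> Y" for u
    using that unfolding Y_def walk_end_def good_def by blast
  then obtain z x where zx: "\<And>u. u \<in> Y \<Longrightarrow> good u (z u) (x u)" by metis
  define L where "L u = insert (z u) (x u ` T)" for u
  \<comment> \<open>\<open>G1\<close> holds the ends of arcs from \<open>u\<close> with label
    \<open>w\<close>, \<open>G2\<close> those of arcs labelled by their own end. Outside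
    \<open>G u\<close> the new label and the new end are fresh and distinct.\<close>
  define G1 where "G1 u w = {v \<in> Fp p. [\<alpha> * (v - u) = c t * w] (mod int p)}" for u w
  define G2 where "G2 u = {v \<in> Fp p. [\<alpha> * (v - u) = c t * v] (mod int p)}" for u
  define G where "G u = (\<Union>w\<in>L u. G1 u w) \<union> L u \<union> G2 u" for u
  have finL: "finite (L u)" for u unfolding L_def using insert.hyps by simp
  \<comment> \<open>The new index \<open>t\<close> is counted in \<open>K\<close>, which leaves room
    for the starting point besides the values on \<open>T\<close>.\<close>
  have cL: "card (L u) \<le> K" for u
  proof -
    have "card (L u) \<le> Suc (card (x u ` T))" unfolding L_def by (rule card_insert_le_m1) auto
    also have "\<dots> \<le> Suc (card T)" using insert.hyps(1) by (simp add: card_image_le)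
    also have "\<dots> \<le> K" using insert.prems(1) insert.hyps by simp
    finally show ?thesis .
  qed
  have finFp: "finite (Fp p)" unfolding Fp_def by simp
  have cG1: "card (G1 u w) \<le> 1" for u w
  proof (rule card_le_1I)
    fix v v' assume v: "v \<in> G1 u w" "v' \<in> G1 u w"
    then have "[\<alpha> * (v - u) = \<alpha> * (v' - u)] (mod int p)"
      unfolding G1_def by (auto intro: cong_trans cong_sym)
    then have "[\<alpha> * v = \<alpha> * v'] (mod int p)" by (simp add: cong_iff_dvd_diff algebra_simps)
    with v show "v = v'" using cong_mult_unique[OF p] unfolding G1_def by blast
  qed
  have cG2: "card (G2 u) \<le> 1" if u: "u \<in> Y" for u
  proof (rule card_le_1I)
    fix v v' assume v: "v \<in> G2 u" "v' \<in> G2 u"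
    have eq: "[(\<alpha> - c t) * w = \<alpha> * u] (mod int p)" if "w \<in> G2 u" for w
      using that unfolding G2_def by (simp add: cong_iff_dvd_diff algebra_simps)
    \<comment> \<open>If this coefficient vanished modulo \<open>p\<close>, then
      \<open>\<alpha> * u\<close> would too, forcing \<open>u = 0\<close>, which \<open>A1\<close>
      excludes.\<close>
    have "\<not> int p dvd \<alpha> - c t"
    proof
      assume "int p dvd \<alpha> - c t"
      then have "int p dvd \<alpha> * u" using eq[OF v(1)] by (metis cong_dvd_iff dvd_mult2)
      then have "[\<alpha> * u = \<alpha> * 0] (mod int p)" by (simp add: cong_0_iff)
      moreover have "0 \<in> Fp p" unfolding Fp_def using p(1) prime_gt_0_nat by auto
      ultimately have "u = 0" using cong_mult_unique[OF p] u YFp by blast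
      with u show False using A(2) unfolding Y_def by auto
    qed
    moreover have "[(\<alpha> - c t) * v = (\<alpha> - c t) * v'] (mod int p)"
      using eq[OF v(1)] eq[OF v(2)] by (meson cong_sym cong_trans)
    ultimately show "v = v'" using cong_mult_unique[OF p(1)] v unfolding G2_def by blast
  qed
  have G: "finite (G u) \<and> card (G u) \<le> 2 * K + 1" if u: "u \<in> Y" for u
  proof
    show "finite (G u)"
      unfolding G_def G1_def G2_def using finL finFp by auto
    have "card (\<Union>w\<in>L u. G1 u w) \<le> (\<Sum>w\<in>L u. card (G1 u w))" by (rule card_UN_le[OF finL])
    also have "\<dots> \<le> (\<Sum>w\<in>L u. 1)" by (rule sum_mono) (rule cG1)
    also have "\<dots> \<le> K" using cL by simp
    finally have "card (\<Union>w\<in>L u. G1 u w) \<le> K" .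
    moreover have "card (G u) \<le> card ((\<Union>w\<in>L u. G1 u w) \<union> L u) + card (G2 u)"
      unfolding G_def by (rule card_Un_le)
    moreover have "card ((\<Union>w\<in>L u. G1 u w) \<union> L u) \<le> card (\<Union>w\<in>L u. G1 u w) + card (L u)"
      by (rule card_Un_le)
    ultimately show "card (G u) \<le> 2 * K + 1" using cL[of u] cG2[OF u] by linarith
  qed
  have "\<exists>U\<subseteq>Y. card Y \<le> (2 * (2 * K + 1) + 1) * card U \<and> (\<forall>u\<in>U. \<forall>v\<in>U. u \<noteq> v \<longrightarrow> v \<notin> G u)"
    by (rule sparse_digraph_independent_set[OF finY]) (rule G)
  then obtain U where U: "U \<subseteq> Y" "card Y \<le> (2 * (2 * K + 1) + 1) * card U" "\<forall>u\<in>U. \<forall>v\<in>U. u \<noteq> v \<longrightarrow> v \<notin> G u"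
    by blast
  have "real (card U) \<le> M"
  proof (rule dilate_independence_bound[OF p _ bound])
    show "\<not> int p dvd c t" using insert.prems(2) by simp
    show "U \<subseteq> Fp p" using U(1) YFp by simp
    fix u v w assume uvw: "u \<in> U" "v \<in> U" "u \<noteq> v" "w \<in> A"
    have uY: "u \<in> Y" and vY: "v \<in> Y" using uvw U(1) by auto
    show "\<not> [\<alpha> * (v - u) = c t * w] (mod int p)"
    proof
      assume step: "[\<alpha> * (v - u) = c t * w] (mod int p)"
      have vG: "v \<notin> G u" using U(3) uvw by blast
      have vFp: "v \<in> Fp p" using vY YFp by auto
      have w: "w \<notin> L u" using vG step vFp unfolding G_def G1_def by blast
      have v: "v \<notin> L u" using vG unfolding G_def by blast
      have vw: "v \<noteq> w" using vG step vFp unfolding G_def G2_def by blast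
      define x' where "x' = (x u)(t := w)"
      have good: "z u \<in> A1" "inj_on (x u) T" "x u ` T \<subseteq> A" "z u \<notin> x u ` T"
        "[\<alpha> * u = \<alpha> * z u + (\<Sum>t\<in>T. c t * x u t)] (mod int p)"
        using zx[OF uY] unfolding good_def by auto
      have x'T: "x' s = x u s" if "s \<in> T" for s using that insert.hyps(2) unfolding x'_def by auto
      have x't: "x' t = w" unfolding x'_def by simp
      have im: "x' ` T = x u ` T" using x'T by auto
      have imi: "x' ` insert t T = insert w (x u ` T)" using im x't by simp
      have sum: "(\<Sum>s\<in>insert t T. c s * x' s) = c t * w + (\<Sum>s\<in>T. c s * x u s)"
        using insert.hyps x'T x't by (simp cong: sum.cong)
      have "inj_on x' T" using good(2) x'T by (simp add: inj_on_def)
      then have "inj_on x' (insert t T)" using w insert.hyps(2) im x't unfolding L_def by simp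
      moreover have "[\<alpha> * v = \<alpha> * z u + (\<Sum>s\<in>insert t T. c s * x' s)] (mod int p)"
      proof -
        have "[\<alpha> * (v - u) + \<alpha> * u = c t * w + (\<alpha> * z u + (\<Sum>t\<in>T. c t * x u t))] (mod int p)"
          by (rule cong_add[OF step good(5)])
        then show ?thesis unfolding sum by (simp add: algebra_simps)
      qed
      ultimately have "walk_end p \<alpha> c A A1 (insert t T) v"
        unfolding walk_end_def using good(1,3,4) w v vw uvw(4) imi
        by (intro bexI[of _ "z u"] exI[of _ x']) (auto simp: L_def)
      with vY show False unfolding Y_def by simp
    qed
  qed
  moreover have "real (card Y) \<le> real ((4 * K + 3) * card U)"
    by (rule of_nat_mono) (use U(2) in \<open>simp add: algebra_simps\<close>)
  moreover have "real ((4 * K + 3) * card U) = real (4 * K + 3) * real (card U)" by (rule of_nat_mult)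
  moreover have "real (4 * K + 3) * real (card U) \<le> real (4 * K + 3) * M"
    using \<open>real (card U) \<le> M\<close> by (rule mult_left_mono) simp
  ultimately have cY: "real (card Y) \<le> real (4 * K + 3) * M" by linarith
  have "{v \<in> A1. \<not> walk_end p \<alpha> c A A1 (insert t T) v} \<subseteq> {v \<in> A1. \<not> walk_end p \<alpha> c A A1 T v} \<union> Y"
    unfolding Y_def by blast
  then have "card {v \<in> A1. \<not> walk_end p \<alpha> c A A1 (insert t T) v} \<le> card ({v \<in> A1. \<not> walk_end p \<alpha> c A A1 T v} \<union> Y)"
    using finA1 finY by (intro card_mono) auto
  also have "\<dots> \<le> card {v \<in> A1. \<not> walk_end p \<alpha> c A A1 T v} + card Y" by (rule card_Un_le)
  finally have "real (card {v \<in> A1. \<not> walk_end p \<alpha> c A A1 (insert t T) v}) \<le>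
      real (card {v \<in> A1. \<not> walk_end p \<alpha> c A A1 T v}) + real (card Y)"
    by (metis of_nat_add of_nat_le_iff)
  moreover have "real (card {v \<in> A1. \<not> walk_end p \<alpha> c A A1 T v}) \<le> real (card T) * (real (4 * K + 3) * M)"
    by (rule insert.IH) (use insert.prems insert.hyps in auto)
  moreover have "real (card (insert t T)) * (real (4 * K + 3) * M)
      = real (card T) * (real (4 * K + 3) * M) + real (4 * K + 3) * M"
    using insert.hyps by (simp add: distrib_right)
  ultimately show ?case using cY by linarith
qed

subsection \<open>Density bounds\<close>

text \<open>A walk from \<open>z\<close> to \<open>z'\<close> and an extension of \<open>z'\<close>
  add up to a solution in which \<open>z\<close> receives the index \<open>i\<close> and
  \<open>z'\<close> cancels. So the extendable nonzero points are never walk ends, and the failure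
  bound for walks bounds their number. The \<open>+ 2\<close> pays for the nonextendable points and
  for \<open>0\<close>.\<close>

lemma card_le_of_walks:
  fixes c :: "nat \<Rightarrow> int" and \<epsilon> :: real
  assumes c: "\<forall>i\<in>{1..k}. c i \<noteq> 0" and \<epsilon>: "\<epsilon> > 0"
    and S: "S \<subseteq> {1..k}" "S \<noteq> {}" "S \<noteq> {1..k}" "(\<Sum>s\<in>S. c s) = 0"
  shows "\<exists>N0. \<forall>p\<ge>N0. prime p \<longrightarrow> (\<forall>A\<subseteq>Fp p. solution_free k c p A \<longrightarrow>
           real (independence_number (with_proj (cayley_digraph p A))) \<le> \<epsilon> * real p \<longrightarrow>
           real (card A) \<le> (real k * real (4 * k + 3) + 2) * \<epsilon> * real p)"
proof -
  define T where "T = {1..k} - S"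
  obtain i where i: "i \<in> S" using S(2) by blast
  have finS: "finite S" using S(1) finite_subset by blast
  have finT: "finite T" unfolding T_def by simp
  have Tne: "T \<noteq> {}" using S unfolding T_def by auto
  have cT: "card T + card S = k"
    using card_Diff_subset[OF finS S(1)] card_mono[OF _ S(1)] unfolding T_def by simp
  moreover have "card S > 0" using S(2) finS by (simp add: card_gt_0_iff)
  ultimately have cT': "card T + 1 \<le> k" by simp
  have "\<forall>i\<in>S. c i \<noteq> 0" using c S(1) by blast
  from few_nonextendable_zero_sum[OF finS i this S(4) \<epsilon>, of k] obtain N1 where
    N1: "\<And>N A. N \<ge> N1 \<Longrightarrow> A \<subseteq> {0..<int N} \<Longrightarrow> real (card {z \<in> A. \<not> extendable c S i k A z}) \<le> \<epsilon> * real N"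
    by meson
  \<comment> \<open>\<open>p \<ge> N2\<close> gives \<open>1 \<le> \<epsilon> * p\<close>, which
    absorbs the point \<open>0\<close>; \<open>p \<ge> N3\<close> makes all coefficients units
    modulo \<open>p\<close>.\<close>
  obtain N2 :: nat where N2: "real N2 \<ge> 1 / \<epsilon>" using real_arch_simple by blast
  define N3 where "N3 = Suc (\<Sum>i\<in>{1..k}. nat \<bar>c i\<bar>)"
  show ?thesis
  proof (rule exI[of _ "max N1 (max N2 N3)"], intro allI impI)
    fix p :: nat and A assume pN: "max N1 (max N2 N3) \<le> p" and p: "prime p" and A: "A \<subseteq> Fp p"
      and sf: "solution_free k c p A"
      and ind: "real (independence_number (with_proj (cayley_digraph p A))) \<le> \<epsilon> * real p"
    have finA: "finite A" using finite_subset[OF A] unfolding Fp_def by simp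
    have ndvd: "\<not> int p dvd c s" if s: "s \<in> {1..k}" for s
    proof
      assume "int p dvd c s"
      then have "int p \<le> \<bar>c s\<bar>" using c s by (simp add: zdvd_imp_le)
      moreover have "nat \<bar>c s\<bar> \<le> (\<Sum>i\<in>{1..k}. nat \<bar>c i\<bar>)"
        by (rule member_le_sum[of s]) (use s in auto)
      ultimately show False using pN unfolding N3_def by linarith
    qed
    have bound: "real (card U) \<le> \<epsilon> * real p"
      if "U \<subseteq> Fp p" "\<And>u v. u \<in> U \<Longrightarrow> v \<in> U \<Longrightarrow> u \<noteq> v \<Longrightarrow> (v - u) mod int p \<notin> A" for U
      using card_le_independence_number[OF that] ind by linarith
    define A1 where "A1 = {z \<in> A - {0}. extendable c S i k A z}"
    have A1A: "A1 \<subseteq> A - {0}" unfolding A1_def by auto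
    have no_end: "\<not> walk_end p (c i) c A A1 T z'" if "z' \<in> A1" for z'
    proof
      assume "walk_end p (c i) c A A1 T z'"
      then obtain z x where z: "z \<in> A1" and x: "inj_on x T" "x ` T \<subseteq> A" "z \<notin> x ` T"
        and walk: "[c i * z' = c i * z + (\<Sum>t\<in>T. c t * x t)] (mod int p)"
        and z': "z' \<notin> insert z (x ` T)"
        using Tne unfolding walk_end_def by auto
      \<comment> \<open>At most \<open>card T + 1 \<le> k\<close> labels. As \<open>T\<close> is
        nonempty, \<open>z'\<close> is not among them, so extendability applies.\<close>
      define F where "F = insert z (x ` T)"
      have "card F \<le> Suc (card (x ` T))" unfolding F_def by (rule card_insert_le_m1) auto
      also have "\<dots> \<le> Suc (card T)" using finT by (simp add: card_image_le)
      finally have "finite F \<and> card F \<le> k \<and> z' \<notin> F" using finT cT' z' unfolding F_def by simp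
      moreover have "extendable c S i k A z'" using \<open>z' \<in> A1\<close> unfolding A1_def by simp
      ultimately obtain y where y: "inj_on y (S - {i})" "y ` (S - {i}) \<subseteq> A - F"
        "c i * z' + (\<Sum>s\<in>S - {i}. c s * y s) = 0"
        unfolding extendable_def by meson
      define a where "a s = (if s = i then z else if s \<in> S then y s else x s)" for s
      have a: "a i = z" "\<And>s. s \<in> S - {i} \<Longrightarrow> a s = y s" "\<And>t. t \<in> T \<Longrightarrow> a t = x t"
        using i unfolding a_def T_def by auto
      have k_eq: "{1..k} = insert i ((S - {i}) \<union> T)" using S(1) i unfolding T_def by auto
      have imS: "a ` (S - {i}) = y ` (S - {i})" using a(2) by (intro image_cong) auto
      have imT: "a ` T = x ` T" using a(3) by (intro image_cong) auto
      have injS: "inj_on a (S - {i})" using y(1) a(2) by (simp add: inj_on_def)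
      have injT: "inj_on a T" using x(1) a(3) by (simp add: inj_on_def)
      have disj: "y ` (S - {i}) \<inter> x ` T = {}" "z \<notin> y ` (S - {i})" using y(2) unfolding F_def by auto
      have "inj_on a {1..k}"
        unfolding k_eq inj_on_insert inj_on_Un using injS injT imS imT disj x(3) a(1)
        by (auto simp: image_Un T_def)
      moreover have "\<forall>s\<in>{1..k}. a s \<in> A"
      proof -
        have "a ` {1..k} = insert z (y ` (S - {i}) \<union> x ` T)"
          unfolding k_eq using imS imT a(1) by (simp add: image_Un)
        also have "\<dots> \<subseteq> A" using y(2) x(2) z A1A by auto
        finally show ?thesis by blast
      qed
      moreover have "[(\<Sum>s\<in>{1..k}. c s * a s) = 0] (mod int p)"
      proof -
        have "(\<Sum>s\<in>{1..k}. c s * a s) = (\<Sum>s\<in>S. c s * a s) + (\<Sum>t\<in>T. c t * a t)"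
          unfolding T_def using sum.subset_diff[OF S(1), of "\<lambda>s. c s * a s"] by simp
        also have "(\<Sum>s\<in>S. c s * a s) = c i * z + (\<Sum>s\<in>S - {i}. c s * y s)"
          using sum.remove[OF finS i, of "\<lambda>s. c s * a s"] a(1,2) by simp
        also have "(\<Sum>t\<in>T. c t * a t) = (\<Sum>t\<in>T. c t * x t)" using a(3) by simp
        finally have "(\<Sum>s\<in>{1..k}. c s * a s) = (c i * z + (\<Sum>t\<in>T. c t * x t)) - c i * z'"
          using y(3) by simp
        then show ?thesis using walk by (simp add: cong_iff_dvd_diff dvd_diff_commute)
      qed
      ultimately show False using sf unfolding solution_free_def by blast
    qed
    have "{z' \<in> A1. \<not> walk_end p (c i) c A A1 T z'} = A1" using no_end by auto
    then have "real (card A1) \<le> real (card T) * (real (4 * k + 3) * (\<epsilon> * real p))"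
      using card_non_walk_ends[OF p _ A A1A bound finT, of "c i" k c] ndvd i S(1) cT'
      unfolding T_def by auto
    also have "\<dots> \<le> real k * (real (4 * k + 3) * (\<epsilon> * real p))"
      using cT' \<epsilon> by (intro mult_right_mono) auto
    finally have cA1: "real (card A1) \<le> real k * (real (4 * k + 3) * (\<epsilon> * real p))" .
    have "A \<subseteq> A1 \<union> {z \<in> A. \<not> extendable c S i k A z} \<union> {0}" unfolding A1_def by auto
    then have "card A \<le> card (A1 \<union> {z \<in> A. \<not> extendable c S i k A z} \<union> {0})"
      using finA by (intro card_mono) (auto simp: A1_def)
    also have "\<dots> \<le> card (A1 \<union> {z \<in> A. \<not> extendable c S i k A z}) + 1"
      using card_Un_le[of _ "{0}"] by (metis card_1_singleton_iff One_nat_def)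
    also have "\<dots> \<le> card A1 + card {z \<in> A. \<not> extendable c S i k A z} + 1"
      using card_Un_le by simp
    finally have "real (card A) \<le> real (card A1) + real (card {z \<in> A. \<not> extendable c S i k A z}) + 1"
      by linarith
    moreover have "real (card {z \<in> A. \<not> extendable c S i k A z}) \<le> \<epsilon> * real p"
      using N1 pN A unfolding Fp_def by simp
    moreover have "1 \<le> \<epsilon> * real p"
    proof -
      have "1 / \<epsilon> \<le> real p" using N2 pN by linarith
      then show ?thesis using \<epsilon> by (simp add: field_simps)
    qed
    ultimately show "real (card A) \<le> (real k * real (4 * k + 3) + 2) * \<epsilon> * real p"
      using cA1 by (simp add: algebra_simps)
  qed
qed

lemma card_le_of_zero_sum:
  fixes c :: "nat \<Rightarrow> int" and \<delta> :: real
  assumes "k \<ge> 3" "\<forall>i\<in>{1..k}. c i \<noteq> 0" "(\<Sum>i\<in>{1..k}. c i) = 0" "\<delta> > 0"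
  shows "\<exists>N0. \<forall>p\<ge>N0. \<forall>A\<subseteq>Fp p. solution_free k c p A \<longrightarrow> real (card A) \<le> \<delta> * real p"
proof -
  have "solvable_in_dense_sets c {1..k}"
    by (rule roth_linear_equation) (use assms in auto)
  then obtain N0 where N0: "\<And>N A. N \<ge> N0 \<Longrightarrow> A \<subseteq> {0..<int N} \<Longrightarrow> \<delta> * real N \<le> real (card A) \<Longrightarrow>
      \<exists>x. inj_on x {1..k} \<and> x ` {1..k} \<subseteq> A \<and> (\<Sum>i\<in>{1..k}. c i * x i) = 0"
    unfolding solvable_in_dense_sets_def using assms(4) by meson
  show ?thesis
  proof (rule exI[of _ N0], intro allI impI, rule ccontr)
    fix p A assume p: "N0 \<le> p" and A: "A \<subseteq> Fp p" "solution_free k c p A" "\<not> real (card A) \<le> \<delta> * real p"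
    then obtain x where x: "inj_on x {1..k}" "x ` {1..k} \<subseteq> A" "(\<Sum>i\<in>{1..k}. c i * x i) = 0"
      using N0[of p A] unfolding Fp_def by auto
    have "\<forall>i\<in>{1..k}. x i \<in> A" using x(2) by blast
    moreover have "[(\<Sum>i\<in>{1..k}. c i * x i) = 0] (mod int p)" unfolding x(3) by simp
    ultimately show False using A(2) x(1) unfolding solution_free_def by blast
  qed
qed

section \<open>From bounds on sets to the limit superior\<close>

lemma D_max_le:
  assumes "\<And>A. A \<subseteq> Fp p \<Longrightarrow> solution_free k c p A \<Longrightarrow>
      real (independence_number (with_proj (cayley_digraph p A))) \<le> \<epsilon> * real p \<Longrightarrow> real (card A) \<le> B"
    and "B \<ge> 0"
  shows "real (D_max k c \<epsilon> p) \<le> B"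
proof -
  define \<A> where "\<A> = {A. A \<subseteq> Fp p \<and> solution_free k c p A \<and>
       real (independence_number (with_proj (cayley_digraph p A))) \<le> \<epsilon> * real p}"
  have D: "D_max k c \<epsilon> p = Sup (card ` \<A>)" unfolding D_max_def \<A>_def by simp
  show ?thesis
  proof (cases "\<A> = {}")
    \<comment> \<open>The supremum of the empty set of naturals is \<open>0\<close>, whence the
      hypothesis \<open>B \<ge> 0\<close>.\<close>
    case True
    then show ?thesis using assms(2) D by simp
  next
    case False
    have "finite \<A>" by (rule finite_subset[of _ "Pow (Fp p)"]) (auto simp: \<A>_def Fp_def)
    then have "Sup (card ` \<A>) \<in> card ` \<A>" using False by (simp add: Sup_nat_def)
    then show ?thesis using assms(1) D unfolding \<A>_def by auto
  qed
qed

theorem theorem3p1: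
  fixes k :: nat and c :: "nat \<Rightarrow> int"
  assumes "k \<ge> 3"
    and "\<forall>i\<in>{1..k}. c i \<noteq> 0"
    and "degenerate k c"
  shows "\<forall>\<epsilon>::real. \<epsilon> > 0 \<longrightarrow>
           d_limsup k c \<epsilon> \<le> ereal (100 ^ (k + 1) * real k ^ 3 * \<epsilon>)"
proof (intro allI impI)
  fix \<epsilon> :: real assume \<epsilon>: "\<epsilon> > 0"
  define C where "C = 100 ^ (k + 1) * real k ^ 3"
  have k1: "1 \<le> real k" using assms(1) by simp
  \<comment> \<open>The 9 is \<open>4 + 3 + 2\<close>, each power of \<open>k\<close> being at most
    \<open>k ^ 3\<close>.\<close>
  have "real k * real (4 * k + 3) + 2 \<le> 9 * real k ^ 3"
  proof -
    have "real k ^ 1 \<le> real k ^ 3" "real k ^ 2 \<le> real k ^ 3"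
      by (rule power_increasing, simp, rule k1)+
    moreover have "1 \<le> real k ^ 3" by (rule one_le_power[OF k1])
    moreover have "real k * real (4 * k + 3) + 2 = 4 * real k ^ 2 + 3 * real k ^ 1 + 2"
      by (simp add: algebra_simps power2_eq_square)
    ultimately show ?thesis by linarith
  qed
  also have "\<dots> \<le> C"
  proof -
    have "(100::real) ^ 1 \<le> 100 ^ (k + 1)" by (rule power_increasing) auto
    then have "(9::real) \<le> 100 ^ (k + 1)" unfolding power_one_right by linarith
    then show ?thesis unfolding C_def by (rule mult_right_mono) simp
  qed
  finally have C: "real k * real (4 * k + 3) + 2 \<le> C" .
  then have C0: "C > 0" using k1 by (smt (verit) mult_nonneg_nonneg of_nat_0_le_iff)
  have "\<exists>N0. \<forall>p\<ge>N0. prime p \<longrightarrow> (\<forall>A\<subseteq>Fp p. solution_free k c p A \<longrightarrow>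
           real (independence_number (with_proj (cayley_digraph p A))) \<le> \<epsilon> * real p \<longrightarrow>
           real (card A) \<le> C * \<epsilon> * real p)"
  proof -
    obtain S where S: "S \<subseteq> {1..k}" "S \<noteq> {}" "(\<Sum>s\<in>S. c s) = 0"
      using assms(3) unfolding degenerate_def by blast
    show ?thesis
    proof (cases "S = {1..k}")
      \<comment> \<open>Here solution-free sets have density tending to 0, so any positive bound
        serves.\<close>
      case True
      have "C * \<epsilon> > 0" using C0 \<epsilon> by simp
      from card_le_of_zero_sum[OF assms(1,2) S(3)[unfolded True] this] show ?thesis by meson
    next
      case False
      have "(real k * real (4 * k + 3) + 2) * \<epsilon> * real p \<le> C * \<epsilon> * real p" for p :: nat
        using C \<epsilon> by (intro mult_right_mono) auto
      with card_le_of_walks[OF assms(2) \<epsilon> S(1,2) False S(3)] show ?thesis by (meson order_trans)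
    qed
  qed
  then obtain N0 where N0: "\<And>p A. p \<ge> N0 \<Longrightarrow> prime p \<Longrightarrow> A \<subseteq> Fp p \<Longrightarrow> solution_free k c p A \<Longrightarrow>
      real (independence_number (with_proj (cayley_digraph p A))) \<le> \<epsilon> * real p \<Longrightarrow>
      real (card A) \<le> C * \<epsilon> * real p"
    by meson
  have "ereal (real (D_max k c \<epsilon> p) / real p) \<le> ereal (C * \<epsilon>)" if p: "p \<ge> N0" "prime p" for p
  proof -
    have "real (D_max k c \<epsilon> p) \<le> C * \<epsilon> * real p"
      by (rule D_max_le) (use N0[OF p] C0 \<epsilon> in auto)
    then show ?thesis using p(2) prime_gt_0_nat[of p] by (simp add: field_simps)
  qed
  then have "eventually (\<lambda>p. ereal (real (D_max k c \<epsilon> p) / real p) \<le> ereal (C * \<epsilon>))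
      (inf sequentially (principal {p. prime p}))"
    unfolding eventually_inf_principal by (auto simp: eventually_sequentially)
  then show "d_limsup k c \<epsilon> \<le> ereal (100 ^ (k + 1) * real k ^ 3 * \<epsilon>)"
    unfolding d_limsup_def C_def by (rule Limsup_bounded)
qed

end
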